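(* Let $\mathcal G$ be an undirected connected weighted graph on $n\ge 2$ agents with Laplacian $L$, let $f_1,\dots,f_n:\mathbb R^m\to\mathbb R$ be differentiable and let $f=\frac1n\sum_{i=1}^n f_i$. Assume: (i) each $f_i$ satisfies $\|\nabla f_i(x)-\nabla f_i(y)\|\le L_f\|x-y\|$ for all $x,y\in\mathbb R^m$, with $L_f>0$; (ii) the set of minimizers of $f$ is nonempty and $f^\star=\min_{x} f(x)>-\infty$; (iii) $f$ satisfies the Polyak--Łojasiewicz condition $\frac12\|\nabla f(x)\|^2\ge\nu(f(x)-f^\star)$ for all $x\in\mathbb R^m$, with $\nu>0$. Let every agent run the quantized distributed gradient tracking algorithm (defined in the context) with common parameters $\beta,\delta,\mu,\mathcal K,s(0)$ such that $$\beta\in\Big(0,\tfrac{\sqrt2}{2\rho(L)}\Big),\quad \delta\in\Big(0,\min\Big\{\tfrac{\sqrt{c_1\Theta_1}}{2},\tfrac1{4L_f},\tfrac2\nu,\tfrac1{8+2L_f},\tfrac{\sqrt{c_1}}{8L_f}\Big\}\Big),\quad \mu\in(\sqrt{\bar\rho},1),\quad \mathcal K\ge\max\{\vartheta_1,\vartheta_2\},$$ $$s(0)\ge\max\Big\{\tfrac{2(C_x+\delta C_u)}{2\mathcal K+1},\ \tfrac{2\|\nabla F(\mathbf x(0)-\delta\mathbf u(0))\|_\infty}{2\mathcal K+1},\ \sqrt{\tfrac{4\|\Lambda(0)\|\mu^2(\mu^2-\bar\rho)}{\sigma_2}}\Big\},$$ where $C_x\ge\|\mathbf x(0)\|_\infty$,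 $C_u\ge\|\mathbf u(0)\|_\infty$, and all other constants are those defined in the context. Then for all $k\ge0$ $$\|\mathbf x(k)-\bar{\mathbf x}(k)\|^2+n\big(f(\bar x(k))-f^\star\big)\le\sigma_9\,\mu^{2k},\qquad \sigma_9=\frac{h\sigma_2s^2(0)}{2\mu^2(\mu^2-\bar\rho)}.$$
   Context: Graph. $\mathcal G=(\mathcal V,\mathcal E,\mathcal A)$, $\mathcal V=\{1,\dots,n\}$, symmetric adjacency matrix $\mathcal A=[a_{ij}]$ with $a_{ij}>0$ if $(j,i)\in\mathcal E$ and $a_{ij}=0$ otherwise; $d_i=\sum_j a_{ij}$ is the weighted degree, $d=\max_i d_i$ is the maximum degree, $L=[L_{ij}]=\mathrm{diag}[d_1,\dots,d_n]-\mathcal A$. $\rho(\cdot)$ is the spectral radius; $\|\cdot\|$ is the Euclidean vector norm or spectral matrix norm; $\|x\|_\infty=\max_i|x_i|$. Quantizer. For a positive integer $\mathcal K$, the uniform quantizer with $2\mathcal K+1$ levels is $q[a]=j$ if $\frac{2j-1}2<a\le\frac{2j+1}2$, $j=0,\dots,\mathcal K$; $q[a]=\mathcal K$ if $a>\frac{2\mathcal K+1}2$; $q[a]=-q[-a]$ if $a\le-\frac12$. For vectors, $Q[l]$ applies $q$ componentwise. Encoder/decoder. Let $s(k)=s(0)\mu^k$ with $s(0)>0$, $\mu\in(0,1)$. For a sequence $\mathcal C_j(k)\in\mathbb R^m$ of agent $j$ to be transmitted, the encoder generates, for $k\ge1$, with $b_j^{\mathcal C}(0)=\mathbf 0_m$: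 $z_j^{\mathcal C}(k)=Q\big[\frac1{s(k-1)}(\mathcal C_j(k)-b_j^{\mathcal C}(k-1))\big]$, $b_j^{\mathcal C}(k)=s(k-1)z_j^{\mathcal C}(k)+b_j^{\mathcal C}(k-1)$. The decoder generates the estimate $\hat{\mathcal C}_j(k)=s(k-1)z_j^{\mathcal C}(k)+\hat{\mathcal C}_j(k-1)$, $k\ge1$, with $\hat{\mathcal C}_j(0)=\mathbf 0_m$. Quantized distributed gradient tracking algorithm. Initialize $x_i(0)\in\mathbb R^m$ arbitrary, $u_i(0)=\nabla f_i(x_i(0))$, $\hat x_j(0)=\hat u_j(0)=\mathbf 0_m$. For $k\ge0$: $$x_i(k+1)=x_i(k)-\beta\sum_{j=1}^nL_{ij}\hat x_j(k)-\delta u_i(k),$$ $$u_i(k+1)=u_i(k)-\beta\sum_{j=1}^nL_{ij}\hat u_j(k)+\nabla f_i(x_i(k+1))-\nabla f_i(x_i(k)),$$ and then $\hat x_j(k+1),\hat u_j(k+1)$ are obtained by applying the encoder/decoder to $\mathcal C_j=x_j$ and $\mathcal C_j=u_j$. Stacked notation. $F(\mathbf x)=\sum_i f_i(x_i)$ for $\mathbf x=[x_1^T,\dots,x_n^T]^T$; $\mathbf x(k),\mathbf u(k)$ are the stacked $x_i(k),u_i(k)$; $\bar x(k)=\frac1n\sum_i x_i(k)$, $\bar u(k)=\frac1n\sum_iu_i(k)$, $\bar{\mathbf x}(k)=\mathbf 1_n\otimes\bar x(k)$, $\bar{\mathbf u}(k)=\mathbf 1_n\otimes\bar u(k)$; $\Lambda(0)=[\|\mathbf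 x(0)-\bar{\mathbf x}(0)\|^2,\ \|\mathbf u(0)-\bar{\mathbf u}(0)\|^2,\ n(f(\bar x(0))-f^\star)]^T$. Constants. $\mathbf L=L\otimes\mathbf I_m$, $\mathbf H=\frac1n(\mathbf 1_n\mathbf 1_n^T\otimes\mathbf I_m)$, $\varrho=\rho(\mathbf I_{nm}-\beta\mathbf L-\mathbf H)$; $c_2$ is a constant in $(0,1-\varrho^2)$; $c_1=\frac{(1-\varrho^2-c_2)(1-\varrho^2)}{1+\varrho^2}$; $\Theta_2=\frac{c_1}{32L_f^2}$; $\Theta_1=\min\{\frac{c_1}{24L_f^2},\frac{\nu\Theta_2}{2L_f^2}\}$; $\iota=\min\{\frac{c_2}2,\frac\delta4\nu\}$; $\bar\rho=1-\iota$; $\sigma_1=\frac{1-\varrho^2}{2\varrho^2}$. $\Phi=\begin{bmatrix}\chi_1&\chi_2&0\\\chi_3&\chi_4&\chi_5\\\chi_6&0&\chi_7\end{bmatrix}$ with $\chi_1=(1+\sigma_1)\varrho^2$, $\chi_2=2\delta^2(1+\frac1{\sigma_1})$, $\chi_3=(1+\frac1{\sigma_1})8L_f^2(\beta^2\rho^2(L)+\frac{2\delta^2L_f^2}{1-2\delta L_f})$, $\chi_4=(1+\sigma_1)\varrho^2+(1+\frac1{\sigma_1})8L_f^2\delta^2$, $\chi_5=(1+\frac1{\sigma_1})\frac{16L_f^2\delta(2-\delta\nu)}{1-2\delta L_f}$, $\chi_6=\frac\delta2L_f^2$, $\chi_7=1-\frac\delta2\nu$. $h=\sqrt3\,\frac{\max_{1\le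 i\le3}\zeta_i}{\min_{1\le i\le3}\zeta_i}$, where $\zeta=[\zeta_1,\zeta_2,\zeta_3]^T$ is a positive eigenvector of $\Phi$ for the eigenvalue $\rho(\Phi)$. $\sigma_5=(1+\frac1{\sigma_1})2\beta^2\rho^2(L)$; $\sigma_2=nm\,\sigma_5\sqrt{1+(1+4L_f^2)^2}$; $\sigma_6=\sqrt3\max\{\beta\rho(L),\delta\}$; $\sigma_7=\max\{1-\frac\delta2\nu,\frac\delta2L_f^2\}$; $\sigma_3=\sigma_6\sqrt{2+\frac{4\sigma_7}{\delta(1-2\delta L_f)}}$; $\sigma_4=\beta\rho(L)(1+L_f)+L_f\delta\big(1+\sqrt{\frac{4\sigma_7}{\delta(1-2\delta L_f)}}\big)$. $\vartheta_1=\sigma_3\sqrt{\frac{h\sigma_2}{4\mu^2(\mu^2-\bar\rho)}}+\frac{1+2\beta d}{2\mu}-\frac12$, $\quad\vartheta_2=\sigma_4\sqrt{\frac{h\sigma_2}{4\mu^2(\mu^2-\bar\rho)}}+\frac{\sqrt{nm}L_f\beta\rho(L)}{2\mu}+\frac{1+2\beta d}{2\mu}-\frac12$. *)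

theory Defs
  imports "HOL-Analysis.Analysis"
begin

definition grad :: "('a::real_inner \<Rightarrow> real) \<Rightarrow> 'a \<Rightarrow> 'a" where
  "grad g x = (THE D. GDERIV g x :> D)"

text \<open>The spectrum of a real matrix is taken over the complex numbers; it is finite and
  nonempty, so the supremum is a maximum.\<close>

definition spectral_radius :: "real^'k^'k \<Rightarrow> real" where
  "spectral_radius M = Sup {cmod l |l. \<exists>v::complex^'k.
     v \<noteq> 0 \<and> (\<chi> i j. complex_of_real (M $ i $ j)) *v v = l *s v}"

definition kronecker :: "real^'b^'a \<Rightarrow> real^'d^'c \<Rightarrow> real^('b \<times> 'd)^('a \<times> 'c)" where
  "kronecker M N = (\<chi> p q. M $ fst p $ fst q * N $ snd p $ snd q)"

text \<open>An edge \<open>(j, i)\<close> carries the weight \<open>A $ i $ j\<close>. Self-loops are not excluded; they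
  cancel in the Laplacian but count in the weighted degree.\<close>

definition undirected_weighted_graph :: "('n \<times> 'n) set \<Rightarrow> real^'n^'n \<Rightarrow> bool" where
  "undirected_weighted_graph E A \<longleftrightarrow>
     transpose A = A \<and>
     (\<forall>i j. if (j, i) \<in> E then A $ i $ j > 0 else A $ i $ j = 0)"

definition connected_graph :: "('n \<times> 'n) set \<Rightarrow> bool" where
  "connected_graph E \<longleftrightarrow> (\<forall>i j. (i, j) \<in> E\<^sup>*)"

definition weighted_degree :: "real^'n^'n \<Rightarrow> 'n \<Rightarrow> real" where
  "weighted_degree A i = (\<Sum>j\<in>UNIV. A $ i $ j)"

definition max_degree :: "real^'n^'n \<Rightarrow> real" where
  "max_degree A = Max (range (weighted_degree A))"

definition laplacian :: "real^'n^'n \<Rightarrow> real^'n^'n" where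
  "laplacian A = (\<chi> i j. (if i = j then weighted_degree A i else 0) - A $ i $ j)"

text \<open>The uniform quantizer with \<open>2 * K + 1\<close> levels; \<open>quantizer_pos\<close> is its restriction to
  arguments above \<open>- 1 / 2\<close>, where the index \<open>j\<close> below is unique.\<close>

definition quantizer_pos :: "nat \<Rightarrow> real \<Rightarrow> real" where
  "quantizer_pos K a =
     (if a > (2 * real K + 1) / 2 then real K
      else real (THE j. j \<le> K \<and> (2 * real j - 1) / 2 < a \<and> a \<le> (2 * real j + 1) / 2))"

definition quantizer :: "nat \<Rightarrow> real \<Rightarrow> real" where
  "quantizer K a = (if a \<le> - (1 / 2) then - quantizer_pos K (- a) else quantizer_pos K a)"

definition quantizer_vec :: "nat \<Rightarrow> real^'m \<Rightarrow> real^'m" where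
  "quantizer_vec K v = (\<chi> c. quantizer K (v $ c))"

text \<open>\<open>encoder_out s K C\<close> is the transmitted sequence \<open>z\<close> and \<open>encoder_state s K C\<close> the
  internal state \<open>b\<close>. Nothing is transmitted at time 0; that value is a dummy which the
  decoder never reads.\<close>

fun encoder_out :: "(nat \<Rightarrow> real) \<Rightarrow> nat \<Rightarrow> (nat \<Rightarrow> real^'m) \<Rightarrow> nat \<Rightarrow> real^'m"
  and encoder_state :: "(nat \<Rightarrow> real) \<Rightarrow> nat \<Rightarrow> (nat \<Rightarrow> real^'m) \<Rightarrow> nat \<Rightarrow> real^'m" where
  "encoder_out s K C 0 = 0"
| "encoder_out s K C (Suc k) =
     quantizer_vec K ((1 / s k) *\<^sub>R (C (Suc k) - encoder_state s K C k))"
| "encoder_state s K C 0 = 0"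
| "encoder_state s K C (Suc k) = s k *\<^sub>R encoder_out s K C (Suc k) + encoder_state s K C k"

fun decoder :: "(nat \<Rightarrow> real) \<Rightarrow> (nat \<Rightarrow> real^'m) \<Rightarrow> nat \<Rightarrow> real^'m" where
  "decoder s z 0 = 0"
| "decoder s z (Suc k) = s k *\<^sub>R z (Suc k) + decoder s z k"

text \<open>A stacked vector \<open>[x\<^sub>1, \<dots>, x\<^sub>n]\<close> of agent states is an element of \<open>real^'m^'n\<close>, whose
  \<open>norm\<close> and \<open>infnorm\<close> are the Euclidean and the maximum norm of all \<open>n * m\<close> coordinates.
  The estimates at time \<open>k\<close> only depend on the states up to time \<open>k\<close>, so the equations
  determine the whole run from \<open>x 0\<close>.\<close>

definition quantized_gradient_tracking ::
  "('n \<Rightarrow> real^'m \<Rightarrow> real) \<Rightarrow> real^'n^'n \<Rightarrow> real \<Rightarrow> real \<Rightarrow> (nat \<Rightarrow> real) \<Rightarrow> nat \<Rightarrow>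
   (nat \<Rightarrow> real^'m^'n) \<Rightarrow> (nat \<Rightarrow> real^'m^'n) \<Rightarrow>
   (nat \<Rightarrow> real^'m^'n) \<Rightarrow> (nat \<Rightarrow> real^'m^'n) \<Rightarrow> bool" where
  "quantized_gradient_tracking f A \<beta> \<delta> s K x u xhat uhat \<longleftrightarrow>
     (\<forall>i. u 0 $ i = grad (f i) (x 0 $ i)) \<and>
     (\<forall>k i. x (Suc k) $ i =
        x k $ i - \<beta> *\<^sub>R (\<Sum>j\<in>UNIV. laplacian A $ i $ j *\<^sub>R xhat k $ j) - \<delta> *\<^sub>R u k $ i) \<and>
     (\<forall>k i. u (Suc k) $ i =
        u k $ i - \<beta> *\<^sub>R (\<Sum>j\<in>UNIV. laplacian A $ i $ j *\<^sub>R uhat k $ j)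
        + grad (f i) (x (Suc k) $ i) - grad (f i) (x k $ i)) \<and>
     (\<forall>k j. xhat k $ j = decoder s (encoder_out s K (\<lambda>t. x t $ j)) k) \<and>
     (\<forall>k j. uhat k $ j = decoder s (encoder_out s K (\<lambda>t. u t $ j)) k)"

definition avg_objective :: "('n::finite \<Rightarrow> real^'m \<Rightarrow> real) \<Rightarrow> real^'m \<Rightarrow> real" where
  "avg_objective f y = (1 / real CARD('n)) * (\<Sum>i\<in>UNIV. f i y)"

definition stacked_objective :: "('n::finite \<Rightarrow> real^'m \<Rightarrow> real) \<Rightarrow> real^'m^'n \<Rightarrow> real" where
  "stacked_objective f x = (\<Sum>i\<in>UNIV. f i (x $ i))"

definition agent_mean :: "real^'m^'n \<Rightarrow> real^'m" where
  "agent_mean x = (1 / real CARD('n)) *\<^sub>R (\<Sum>i\<in>UNIV. x $ i)"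

definition stacked_mean :: "real^'m^'n \<Rightarrow> real^'m^'n" where
  "stacked_mean x = (\<chi> i. agent_mean x)"

end

theory Submission
  imports Defs
begin

text \<open>The squared consensus errors \<open>X\<close>, \<open>U\<close> of the states and of the gradient trackers and the
  optimality gap \<open>G\<close> obey a linear recursion with matrix \<open>\<Phi>\<close>, perturbed by the quantization
  errors. The step size conditions say that \<open>(\<Theta>\<^sub>1, 1, \<Theta>\<^sub>2)\<close> is a supersolution of the eigenvalue
  equation with the value \<open>1 - \<iota>\<close>, so the eigenvalue of the positive eigenvector \<open>\<zeta>\<close> is at most
  \<open>1 - \<iota>\<close>, and bounds of the form \<open>c * \<zeta> * \<mu>\<^sup>2\<^sup>k\<close> propagate as long as no quantizer saturates. In
  turn they keep the next quantizer input in range, so the induction closes with \<open>c\<close>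
  proportional to \<open>\<surd>3\<close>.

  The estimates are initially zero, so the first iteration is no consensus step and does not
  contract: the constant after it has to be found separately. It is at most \<open>\<surd>3\<close> unless
  \<open>\<mu>\<^sup>2 < 3 / 4\<close>. In that case \<open>\<delta> * \<nu> > 1\<close>, which forces \<open>f\<close> to be constant, the entries of \<open>\<zeta>\<close>
  spread by a factor of at least 2, and the second iteration gains what is missing.\<close>

section \<open>Spectral radius of symmetric matrices\<close>

text \<open>The scale \<open>B\<close> of the error bounds is dictated by the quantization noise: as
  long as no quantizer saturates, the noise at time \<open>k \<ge> 1\<close> contributes at most
  \<open>B * z ^ k * (z - rhobar)\<close> with \<open>z = \<mu>\<^sup>2\<close>, and
  \<open>z - rhobar\<close> is just the room that the eigenvalue bound leaves. The third lower bound
  on \<open>s0\<close> says that the initial errors are at most \<open>B\<close> too. Errors are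
  compared with the eigenvector entry by entry, so the factor \<open>sqrt 3\<close> in
  \<open>h\<close>, the price of passing between Euclidean and maximum norm in dimension 3, remains
  as slack. It has to pay for the first iteration, and the margins are narrow enough to call for
  explicit decimals. Young's inequality keeps a free parameter throughout, because the first, the
  second and the later iterations need different values of it.\<close>

lemma selfadjoint_extremal_eigenvector:
  fixes T :: "'a::euclidean_space \<Rightarrow> 'a"
  assumes lin: "linear T" and adj: "\<And>v w. T v \<bullet> w = v \<bullet> T w"
  obtains v r where "v \<noteq> 0" "0 \<le> r" "T v = r *\<^sub>R v \<or> T v = - r *\<^sub>R v" "\<And>w. norm (T w) \<le> r * norm w"
proof -
  have bl: "bounded_linear T" using lin by (rule linear_conv_bounded_linear[THEN iffD1])
  obtain e :: 'a where "norm e = 1" using vector_choose_size[of 1] by auto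
  then have "sphere (0::'a) 1 \<noteq> {}" by auto
  moreover have "continuous_on (sphere 0 1) (\<lambda>v. norm (T v))"
    by (intro continuous_on_norm linear_continuous_on bl)
  ultimately obtain v where v: "norm v = 1" and "\<And>w. norm w = 1 \<Longrightarrow> norm (T w) \<le> norm (T v)"
    using continuous_attains_sup[OF compact_sphere, of 0 1 "\<lambda>v. norm (T v)"] by auto
  note max = this(2)
  define r where "r = norm (T v)"
  have bound: "norm (T w) \<le> r * norm w" for w
  proof (cases "w = 0")
    case True
    then show ?thesis using linear_0[OF lin] by simp
  next
    case False
    have "norm (T ((1 / norm w) *\<^sub>R w)) \<le> r" unfolding r_def using False by (intro max) simp
    then show ?thesis using False by (simp add: linear_scale[OF lin] pos_divide_le_eq)
  qed
  \<comment> \<open>First-order optimality of the maximiser: moving \<open>v\<close> in the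
    direction of the residual \<open>g\<close> would raise \<open>norm (T w) / norm w\<close> above
    \<open>r\<close> unless \<open>g = 0\<close>.\<close>
  have TT: "T (T v) = r\<^sup>2 *\<^sub>R v"
  proof -
    define g where "g = T (T v) - r\<^sup>2 *\<^sub>R v"
    have key: "2 * t * (norm g)\<^sup>2 \<le> t\<^sup>2 * (r\<^sup>2 * (norm g)\<^sup>2)" for t
    proof -
      have "r\<^sup>2 + 2 * t * (T (T v) \<bullet> g) + t\<^sup>2 * (norm (T g))\<^sup>2 = (norm (T (v + t *\<^sub>R g)))\<^sup>2"
        unfolding linear_add[OF lin] linear_scale[OF lin] r_def power2_norm_eq_inner
        by (simp add: inner_add_left inner_add_right adj inner_commute power2_eq_square)
      also have "\<dots> \<le> (r * norm (v + t *\<^sub>R g))\<^sup>2" by (intro power_mono bound) simp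
      also have "\<dots> = r\<^sup>2 * (1 + 2 * t * (v \<bullet> g) + t\<^sup>2 * (norm g)\<^sup>2)"
        unfolding power_mult_distrib power2_norm_eq_inner using v
        by (simp add: inner_add_left inner_add_right inner_commute power2_eq_square norm_eq_1)
      finally have le: "2 * t * (T (T v) \<bullet> g - r\<^sup>2 * (v \<bullet> g)) + t\<^sup>2 * (norm (T g))\<^sup>2 \<le> t\<^sup>2 * (r\<^sup>2 * (norm g)\<^sup>2)"
        by (simp add: algebra_simps)
      have eq: "T (T v) \<bullet> g - r\<^sup>2 * (v \<bullet> g) = (norm g)\<^sup>2"
        unfolding power2_norm_eq_inner by (subst (3) g_def) (simp add: inner_diff_left)
      have "0 \<le> t\<^sup>2 * (norm (T g))\<^sup>2" by simp
      then show ?thesis using le[unfolded eq] by linarith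
    qed
    have "g = 0"
    proof (rule ccontr)
      assume "g \<noteq> 0"
      then have g: "0 < (norm g)\<^sup>2" by simp
      define t where "t = 1 / (1 + r\<^sup>2)"
      have t: "0 < t" "t * r\<^sup>2 \<le> 1" by (auto simp: t_def add_pos_nonneg divide_le_eq)
      have "2 * t * (norm g)\<^sup>2 \<le> t * (t * r\<^sup>2) * (norm g)\<^sup>2"
        using key[of t] by (simp add: power2_eq_square mult_ac)
      then have "2 * t \<le> t * (t * r\<^sup>2)" using g by (rule mult_right_le_imp_le)
      then show False using t by (simp add: mult_le_cancel_left)
    qed
    then show ?thesis by (simp add: g_def)
  qed
  have r0: "0 \<le> r" by (simp add: r_def)
  \<comment> \<open>By \<open>TT\<close>, the operator \<open>T - r\<close> annihilates
    \<open>T v + r v\<close>, which is therefore zero or an eigenvector for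
    \<open>r\<close>.\<close>
  define w where "w = T v + r *\<^sub>R v"
  have Tw: "T w = r *\<^sub>R w"
    by (simp add: w_def linear_add[OF lin] linear_scale[OF lin] TT power2_eq_square algebra_simps)
  show thesis
  proof (cases "w = 0")
    case True
    then have "T v = - r *\<^sub>R v" by (simp add: w_def eq_neg_iff_add_eq_0)
    then show thesis using that[of v r] v r0 bound by fastforce
  next
    case False
    then show thesis using that[of w r] Tw r0 bound by simp
  qed
qed

text \<open>Makes the supremum in \<open>spectral_radius\<close> an upper bound for the modulus of
  every eigenvalue. Adding up the rows of the eigenvalue equation bounds \<open>cmod l\<close> by
  the sum of all \<open>cmod (M $ i $ j)\<close>.\<close>

lemma bdd_above_eigenvalues:
  fixes M :: "complex^'k^'k"
  shows "bdd_above {cmod l |l. \<exists>v. v \<noteq> 0 \<and> M *v v = l *s v}"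
proof (rule bdd_aboveI, safe)
  fix l and v :: "complex^'k"
  assume v: "v \<noteq> 0" and ev: "M *v v = l *s v"
  define C where "C = (\<Sum>i\<in>UNIV. \<Sum>j\<in>UNIV. cmod (M $ i $ j))"
  define S where "S = (\<Sum>j\<in>UNIV. cmod (v $ j))"
  obtain i where "v $ i \<noteq> 0" using v by (auto simp: vec_eq_iff)
  then have S: "0 < S" unfolding S_def by (intro sum_pos2[of _ i]) auto
  have row: "cmod l * cmod (v $ i) \<le> (\<Sum>j\<in>UNIV. cmod (M $ i $ j)) * S" for i
  proof -
    have "cmod l * cmod (v $ i) = cmod ((l *s v) $ i)" by (simp add: norm_mult)
    also have "\<dots> = cmod (\<Sum>j\<in>UNIV. M $ i $ j * v $ j)"
      unfolding ev[symmetric] by (simp add: matrix_vector_mult_def)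
    also have "\<dots> \<le> (\<Sum>j\<in>UNIV. cmod (M $ i $ j) * cmod (v $ j))"
      by (rule order_trans[OF norm_sum]) (simp add: norm_mult)
    also have "\<dots> \<le> (\<Sum>j\<in>UNIV. cmod (M $ i $ j) * S)"
      unfolding S_def by (intro sum_mono mult_left_mono member_le_sum) auto
    finally show ?thesis by (simp add: sum_distrib_right)
  qed
  have "cmod l * S = (\<Sum>i\<in>UNIV. cmod l * cmod (v $ i))" by (simp add: S_def sum_distrib_left)
  also have "\<dots> \<le> (\<Sum>i\<in>UNIV. (\<Sum>j\<in>UNIV. cmod (M $ i $ j)) * S)" by (intro sum_mono row)
  also have "\<dots> = C * S" by (simp add: C_def sum_distrib_right)
  finally have "cmod l * S \<le> C * S" .
  then show "cmod l \<le> C" using S by simp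
qed

lemma eigenvalue_le_spectral_radius:
  fixes M :: "real^'k^'k"
  assumes "v \<noteq> 0" "M *v v = r *s v"
  shows "\<bar>r\<bar> \<le> spectral_radius M"
  unfolding spectral_radius_def
proof (rule cSup_upper[OF _ bdd_above_eigenvalues])
  define w :: "complex^'k" where "w = (\<chi> i. complex_of_real (v $ i))"
  have "w \<noteq> 0" using assms(1) by (auto simp: w_def vec_eq_iff)
  moreover have "(\<chi> i j. complex_of_real (M $ i $ j)) *v w = complex_of_real r *s w"
  proof -
    have "(\<Sum>j\<in>UNIV. M $ i $ j * v $ j) = r * v $ i" for i
      using assms(2) by (simp add: matrix_vector_mult_def vec_eq_iff)
    from arg_cong[OF this, of complex_of_real] show ?thesis
      by (simp add: w_def matrix_vector_mult_def vec_eq_iff)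
  qed
  ultimately show "\<bar>r\<bar> \<in> {cmod l |l. \<exists>v. v \<noteq> 0 \<and> (\<chi> i j. complex_of_real (M $ i $ j)) *v v = l *s v}"
    by (intro CollectI exI[of _ "complex_of_real r"]) auto
qed

text \<open>The operator norm of a symmetric matrix is attained at a real eigenvector. This turns
  the spectral radii of the Laplacian and of the consensus matrix into norm estimates.\<close>

lemma symmetric_norm_le_spectral_radius:
  fixes M :: "real^'k^'k"
  assumes "transpose M = M"
  shows "norm (M *v w) \<le> spectral_radius M * norm w"
proof -
  have lin: "linear ((*v) M)" by (rule matrix_vector_mul_linear)
  have adj: "(M *v v) \<bullet> w = v \<bullet> (M *v w)" for v w
    using dot_lmul_matrix[of v M w] assms by (simp add: transpose_matrix_vector[symmetric])
  obtain v r where v: "v \<noteq> 0" "0 \<le> r" "M *v v = r *\<^sub>R v \<or> M *v v = - r *\<^sub>R v"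
    and bound: "\<And>w. norm (M *v w) \<le> r * norm w"
    using selfadjoint_extremal_eigenvector[OF lin adj] by metis
  then have "M *v v = r *s v \<or> M *v v = (- r) *s v" by (simp add: scalar_mult_eq_scaleR)
  then have "r \<le> spectral_radius M"
    using eigenvalue_le_spectral_radius[OF v(1), of M r] eigenvalue_le_spectral_radius[OF v(1), of M "- r"]
      v(2) by auto
  then show ?thesis using bound[of w] mult_right_mono[of r "spectral_radius M" "norm w"] by fastforce
qed

section \<open>Gradients\<close>

lemma grad_eqI:
  assumes "(g has_derivative (\<lambda>h. h \<bullet> D)) (at x)"
  shows "grad g x = D"
  unfolding grad_def gderiv_def
proof (rule the_equality)
  show "(g has_derivative (\<lambda>h. h \<bullet> D)) (at x)" by (rule assms)
  fix D' assume "(g has_derivative (\<lambda>h. h \<bullet> D')) (at x)"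
  from has_derivative_unique[OF this assms] have "h \<bullet> D' = h \<bullet> D" for h by meson
  then show "D' = D" using vector_eq_ldot by blast
qed

lemma has_derivative_grad:
  fixes g :: "'a::euclidean_space \<Rightarrow> real"
  assumes "g differentiable (at x)"
  shows "(g has_derivative (\<lambda>h. h \<bullet> grad g x)) (at x)"
proof -
  obtain g' where g': "(g has_derivative g') (at x)" using assms by (auto simp: differentiable_def)
  interpret bounded_linear g' by (rule has_derivative_bounded_linear[OF g'])
  have "g' h = h \<bullet> (\<Sum>b\<in>Basis. g' b *\<^sub>R b)" for h
  proof -
    have "g' h = g' (\<Sum>b\<in>Basis. (h \<bullet> b) *\<^sub>R b)" by (simp add: euclidean_representation)
    then show ?thesis by (simp add: sum scaleR inner_sum_right mult.commute)
  qed
  then have "g' = (\<lambda>h. h \<bullet> (\<Sum>b\<in>Basis. g' b *\<^sub>R b))" by (rule ext)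
  with g' have d: "(g has_derivative (\<lambda>h. h \<bullet> (\<Sum>b\<in>Basis. g' b *\<^sub>R b))) (at x)" by (rule has_derivative_eq_rhs)
  then show ?thesis using grad_eqI[OF d] by simp
qed

lemma has_derivative_avg_objective:
  fixes f :: "'n::finite \<Rightarrow> real^'m \<Rightarrow> real"
  assumes "\<And>i y. f i differentiable (at y)"
  shows "(avg_objective f has_derivative
    (\<lambda>h. h \<bullet> ((1 / real CARD('n)) *\<^sub>R (\<Sum>i\<in>UNIV. grad (f i) y)))) (at (y :: real^'m))"
proof -
  have "((\<lambda>y. (1 / real CARD('n)) * (\<Sum>i\<in>UNIV. f i y)) has_derivative
      (\<lambda>h. (1 / real CARD('n)) * (\<Sum>i\<in>UNIV. h \<bullet> grad (f i) y))) (at y)"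
    by (intro has_derivative_mult_right has_derivative_sum has_derivative_grad assms)
  then show ?thesis by (simp add: avg_objective_def[abs_def] inner_sum_right)
qed

lemma grad_stacked_objective:
  fixes f :: "'n::finite \<Rightarrow> real^'m \<Rightarrow> real"
  assumes "\<And>i y. f i differentiable (at y)"
  shows "grad (stacked_objective f) x = (\<chi> i. grad (f i) (x $ i))"
proof (rule grad_eqI)
  have "((\<lambda>x. f i (x $ i)) has_derivative (\<lambda>h. (h $ i) \<bullet> grad (f i) (x $ i))) (at x)" for i
    by (rule has_derivative_compose[OF bounded_linear.has_derivative[OF bounded_linear_vec_nth has_derivative_ident]
          has_derivative_grad[OF assms]])
  then have "((\<lambda>x. \<Sum>i\<in>UNIV. f i (x $ i)) has_derivative
      (\<lambda>h. \<Sum>i\<in>UNIV. (h $ i) \<bullet> grad (f i) (x $ i))) (at x)"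
    by (intro has_derivative_sum)
  then show "(stacked_objective f has_derivative (\<lambda>h. h \<bullet> (\<chi> i. grad (f i) (x $ i)))) (at x)"
    by (simp add: stacked_objective_def[abs_def] inner_vec_def)
qed

text \<open>Descent lemma: along the segment, the difference \<open>\<phi>\<close> between
  \<open>g\<close> and its quadratic model has a nonpositive derivative by the Lipschitz bound on
  \<open>G\<close>.\<close>

lemma smooth_upper_bound:
  fixes g :: "'a::euclidean_space \<Rightarrow> real"
  assumes der: "\<And>x. (g has_derivative (\<lambda>h. h \<bullet> G x)) (at x)"
    and lip: "\<And>x y. norm (G x - G y) \<le> L * norm (x - y)"
  shows "g (y + h) \<le> g y + h \<bullet> G y + L / 2 * (norm h)\<^sup>2"
proof -
  define \<phi> where "\<phi> t = g (y + t *\<^sub>R h) - t * (h \<bullet> G y) - L / 2 * t\<^sup>2 * (norm h)\<^sup>2" for t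
  have "\<phi> 1 \<le> \<phi> 0"
  proof (rule DERIV_nonpos_imp_nonincreasing[where f = \<phi> and a = 0 and b = 1])
    fix t :: real assume t: "0 \<le> t" "t \<le> 1"
    have line: "((\<lambda>t. y + t *\<^sub>R h) has_derivative (\<lambda>s. s *\<^sub>R h)) (at t)"
      by (auto intro!: derivative_eq_intros)
    have "((\<lambda>t. g (y + t *\<^sub>R h)) has_derivative (\<lambda>s. (s *\<^sub>R h) \<bullet> G (y + t *\<^sub>R h))) (at t)"
      by (rule has_derivative_compose[OF line der])
    then have "((\<lambda>t. g (y + t *\<^sub>R h)) has_real_derivative h \<bullet> G (y + t *\<^sub>R h)) (at t)"
      by (rule has_derivative_imp_has_field_derivative) simp
    then have d: "(\<phi> has_real_derivative (h \<bullet> G (y + t *\<^sub>R h) - h \<bullet> G y - L * t * (norm h)\<^sup>2)) (at t)"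
      unfolding \<phi>_def[abs_def] by (auto intro!: derivative_eq_intros)
    have "h \<bullet> (G (y + t *\<^sub>R h) - G y) \<le> norm h * norm (G (y + t *\<^sub>R h) - G y)"
      by (rule norm_cauchy_schwarz)
    also have "\<dots> \<le> norm h * (L * norm ((y + t *\<^sub>R h) - y))"
      by (intro mult_left_mono lip) simp
    also have "\<dots> = L * t * (norm h)\<^sup>2" using t by (simp add: power2_eq_square)
    finally have "h \<bullet> G (y + t *\<^sub>R h) - h \<bullet> G y - L * t * (norm h)\<^sup>2 \<le> 0"
      by (simp add: inner_diff_right)
    then show "\<exists>z. (\<phi> has_real_derivative z) (at t) \<and> z \<le> 0" using d by blast
  qed simp
  then show ?thesis by (simp add: \<phi>_def)
qed

text \<open>\<open>w\<close> will be the averaged tracker, which only approximates the gradient.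
  Expanding the square of \<open>G y - w\<close> turns the inner product into squares, and the
  Polyak-Lojasiewicz inequality absorbs the one of \<open>G y\<close>. The term in
  \<open>norm w\<close> stays on the left because it later bounds the mean of the trackers.\<close>

lemma inexact_gradient_descent:
  fixes g :: "'a::euclidean_space \<Rightarrow> real"
  assumes der: "\<And>x. (g has_derivative (\<lambda>h. h \<bullet> G x)) (at x)"
    and lip: "\<And>x y. norm (G x - G y) \<le> L * norm (x - y)"
    and PL: "\<nu> * (g y - c) \<le> 1 / 2 * (norm (G y))\<^sup>2" and \<delta>: "0 \<le> \<delta>"
  shows "g (y - \<delta> *\<^sub>R w) - c + \<delta> / 2 * (1 - \<delta> * L) * (norm w)\<^sup>2
    \<le> (1 - \<delta> * \<nu>) * (g y - c) + \<delta> / 2 * (norm (G y - w))\<^sup>2"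
proof -
  have "g (y + - \<delta> *\<^sub>R w) \<le> g y + (- \<delta> *\<^sub>R w) \<bullet> G y + L / 2 * (norm (- \<delta> *\<^sub>R w))\<^sup>2"
    by (rule smooth_upper_bound[OF der lip])
  then have "g (y - \<delta> *\<^sub>R w) \<le> g y - \<delta> * (w \<bullet> G y) + L / 2 * (\<delta>\<^sup>2 * (norm w)\<^sup>2)"
    by (simp add: power_mult_distrib)
  moreover have "\<delta> / 2 * (norm (G y - w))\<^sup>2
      = \<delta> / 2 * (norm (G y))\<^sup>2 + \<delta> / 2 * (norm w)\<^sup>2 - \<delta> * (w \<bullet> G y)"
    by (simp add: power2_norm_eq_inner inner_diff_left inner_diff_right inner_commute algebra_simps
        add_divide_distrib diff_divide_distrib)
  moreover have "\<delta> * \<nu> * (g y - c) \<le> \<delta> / 2 * (norm (G y))\<^sup>2"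
    using mult_left_mono[OF PL \<delta>] by simp
  moreover have "\<delta> / 2 * (1 - \<delta> * L) * (norm w)\<^sup>2 = \<delta> / 2 * (norm w)\<^sup>2 - L / 2 * (\<delta>\<^sup>2 * (norm w)\<^sup>2)"
    by (simp add: algebra_simps power2_eq_square diff_divide_distrib)
  moreover have "(1 - \<delta> * \<nu>) * (g y - c) = (g y - c) - \<delta> * \<nu> * (g y - c)"
    by (simp add: algebra_simps)
  ultimately show ?thesis by linarith
qed

section \<open>Stacked vectors\<close>

lemma norm_add_sq_le:
  fixes a b :: "'a::real_inner"
  assumes "0 < t"
  shows "(norm (a + b))\<^sup>2 \<le> (1 + t) * (norm a)\<^sup>2 + (1 + 1 / t) * (norm b)\<^sup>2"
proof -
  have "0 \<le> (norm (t *\<^sub>R a - b))\<^sup>2 / t" using assms by simp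
  also have "\<dots> = t * (norm a)\<^sup>2 + (norm b)\<^sup>2 / t - 2 * (a \<bullet> b)"
    using assms by (simp add: power2_norm_eq_inner inner_diff_left inner_diff_right inner_commute field_simps)
  finally show ?thesis
    by (simp add: power2_norm_eq_inner inner_add_left inner_add_right inner_commute algebra_simps)
qed

lemma norm_add_sq_le2:
  fixes a b :: "'a::real_inner"
  shows "(norm (a + b))\<^sup>2 \<le> 2 * (norm a)\<^sup>2 + 2 * (norm b)\<^sup>2"
  using norm_add_sq_le[of 1 a b] by simp

lemma norm_sq_vec: "(norm (y :: real^'m^'n))\<^sup>2 = (\<Sum>i\<in>UNIV. (norm (y $ i))\<^sup>2)"
  by (simp add: norm_vec_def L2_set_def sum_nonneg)

lemma linear_agent_mean: "linear (agent_mean :: real^'m^'n \<Rightarrow> real^'m)"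
  by (rule linearI) (simp_all add: agent_mean_def sum.distrib scaleR_add_right scaleR_sum_right mult.commute)

lemma linear_stacked_mean: "linear stacked_mean"
  by (rule linearI)
    (simp_all add: stacked_mean_def vec_eq_iff linear_add[OF linear_agent_mean] linear_scale[OF linear_agent_mean])

lemmas stacked_mean_simps = linear_add[OF linear_stacked_mean] linear_diff[OF linear_stacked_mean]
  linear_scale[OF linear_stacked_mean] linear_0[OF linear_stacked_mean]

lemma agent_mean_stacked_mean: "agent_mean (stacked_mean y) = agent_mean y"
  unfolding agent_mean_def[of "stacked_mean y"] unfolding stacked_mean_def
  by (simp add: sum_constant_scaleR del: sum_constant)

lemma stacked_mean_idem: "stacked_mean (stacked_mean y) = stacked_mean y"
  by (simp add: stacked_mean_def[of "stacked_mean y"] agent_mean_stacked_mean) (simp add: stacked_mean_def)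

lemma norm_stacked_mean: "(norm (stacked_mean y))\<^sup>2 = real CARD('n) * (norm (agent_mean y))\<^sup>2"
  for y :: "real^'m^'n"
  by (simp add: norm_sq_vec stacked_mean_def)

lemma norm_sq_mean_decomposition:
  fixes y :: "real^'m^'n"
  shows "(norm y)\<^sup>2 = (norm (y - stacked_mean y))\<^sup>2 + (norm (stacked_mean y))\<^sup>2"
proof -
  have "(y - stacked_mean y) \<bullet> stacked_mean y
      = ((\<Sum>i\<in>UNIV. y $ i) - real CARD('n) *\<^sub>R agent_mean y) \<bullet> agent_mean y"
    unfolding inner_vec_def[of "y - stacked_mean y"]
    by (simp add: stacked_mean_def inner_diff_left sum_subtractf inner_sum_left)
  then have "(y - stacked_mean y) \<bullet> stacked_mean y = 0" by (simp add: agent_mean_def)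
  then show ?thesis
    using norm_add_Pythagorean[of "y - stacked_mean y" "stacked_mean y"] by (simp add: orthogonal_def)
qed

lemma norm_deviation_le: "(norm (y - stacked_mean y))\<^sup>2 \<le> (norm y)\<^sup>2"
  using norm_sq_mean_decomposition[of y] by simp

lemma norm_agent_mean_sq_le:
  fixes y :: "real^'m^'n"
  shows "real CARD('n) * (norm (agent_mean y))\<^sup>2 \<le> (norm y)\<^sup>2"
  using norm_sq_mean_decomposition[of y] by (simp add: norm_stacked_mean)

text \<open>The Kronecker product of \<open>L\<close> with the identity, acting on
  \<open>real^'m^'n\<close> directly. The matrix in \<open>varrho\<close> acts on
  \<open>real^('n \<times> 'm)\<close> instead; \<open>flatten\<close> relates the two.\<close>

definition block_mult :: "real^'n^'n \<Rightarrow> real^'m^'n \<Rightarrow> real^'m^'n" where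
  "block_mult L y = (\<chi> i. \<Sum>j\<in>UNIV. L $ i $ j *\<^sub>R y $ j)"

lemma linear_block_mult: "linear (block_mult L)"
  by (rule linearI)
    (simp_all add: block_mult_def vec_eq_iff scaleR_add_right sum.distrib sum_distrib_left algebra_simps)

lemmas block_mult_simps = linear_add[OF linear_block_mult] linear_diff[OF linear_block_mult]
  linear_scale[OF linear_block_mult] linear_0[OF linear_block_mult]

lemma norm_sq_entries: "(norm (y :: real^'m^'n))\<^sup>2 = (\<Sum>i\<in>UNIV. \<Sum>c\<in>UNIV. (y $ i $ c)\<^sup>2)"
  by (simp add: norm_sq_vec) (simp add: norm_vec_def L2_set_def sum_nonneg)

text \<open>The map acts on each of the coordinate columns separately, so the constant for
  \<open>L\<close> itself carries over.\<close>

lemma norm_block_mult_le: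
  fixes y :: "real^'m^'n"
  assumes "transpose L = L"
  shows "norm (block_mult L y) \<le> spectral_radius L * norm y"
proof -
  have sr: "0 \<le> spectral_radius L"
  proof -
    obtain e :: "real^'n" where "norm e = 1" using vector_choose_size[of 1] by auto
    moreover have "0 \<le> spectral_radius L * norm e"
      by (rule order_trans[OF norm_ge_zero symmetric_norm_le_spectral_radius[OF assms]])
    ultimately show ?thesis by simp
  qed
  define col where "col c = (\<chi> i. y $ i $ c)" for c
  have colsq: "(norm v)\<^sup>2 = (\<Sum>i\<in>UNIV. (v $ i)\<^sup>2)" for v :: "real^'n"
    by (simp add: norm_vec_def L2_set_def sum_nonneg)
  have "(norm (block_mult L y))\<^sup>2 = (\<Sum>c\<in>UNIV. \<Sum>i\<in>UNIV. (block_mult L y $ i $ c)\<^sup>2)"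
    unfolding norm_sq_entries by (rule sum.swap)
  also have "\<dots> = (\<Sum>c\<in>UNIV. (norm (L *v col c))\<^sup>2)"
    by (simp add: colsq block_mult_def col_def matrix_vector_mult_def)
  also have "\<dots> \<le> (\<Sum>c\<in>UNIV. (spectral_radius L * norm (col c))\<^sup>2)"
    by (intro sum_mono power_mono symmetric_norm_le_spectral_radius assms) auto
  also have "\<dots> = (spectral_radius L)\<^sup>2 * (\<Sum>c\<in>UNIV. \<Sum>i\<in>UNIV. (y $ i $ c)\<^sup>2)"
    by (simp add: power_mult_distrib sum_distrib_left colsq col_def)
  also have "(\<Sum>c\<in>UNIV. \<Sum>i\<in>UNIV. (y $ i $ c)\<^sup>2) = (norm y)\<^sup>2"
    unfolding norm_sq_entries by (rule sum.swap)
  finally have "(norm (block_mult L y))\<^sup>2 \<le> (spectral_radius L * norm y)\<^sup>2"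
    by (simp add: power_mult_distrib)
  then show ?thesis by (rule power2_le_imp_le) (simp add: sr)
qed

lemma sum_UNIV_prod: "(\<Sum>p\<in>UNIV. g (fst p) (snd p)) = (\<Sum>i\<in>UNIV. \<Sum>c\<in>UNIV. g i c)"
  for g :: "'a::finite \<Rightarrow> 'b::finite \<Rightarrow> real"
  unfolding UNIV_Times_UNIV[symmetric] by (simp add: sum.cartesian_product split_beta)

definition flatten :: "real^'m^'n \<Rightarrow> real^('n \<times> 'm)" where
  "flatten y = (\<chi> p. y $ fst p $ snd p)"

lemma norm_flatten: "norm (flatten y) = norm y"
proof -
  have "(norm (flatten y))\<^sup>2 = (norm y)\<^sup>2"
    unfolding norm_sq_entries sum_UNIV_prod[symmetric, of "\<lambda>i c. (y $ i $ c)\<^sup>2"]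
    by (simp add: norm_vec_def L2_set_def sum_nonneg flatten_def)
  then show ?thesis by simp
qed

lemma kronecker_mat1_flatten:
  "kronecker L (mat 1) *v flatten y = flatten (block_mult L y)"
proof -
  have "(\<Sum>p\<in>UNIV. (L $ i $ fst p * (mat 1 :: real^'b^'b) $ c $ snd p) * (y $ fst p $ snd p))
      = (\<Sum>j\<in>UNIV. L $ i $ j * y $ j $ c)" for i c
  proof -
    have "(\<Sum>p\<in>UNIV. (L $ i $ fst p * (mat 1 :: real^'b^'b) $ c $ snd p) * (y $ fst p $ snd p))
      = (\<Sum>j\<in>UNIV. \<Sum>c'\<in>UNIV. (L $ i $ j * (mat 1 :: real^'b^'b) $ c $ c') * (y $ j $ c'))"
      by (rule sum_UNIV_prod)
    also have "\<dots> = (\<Sum>j\<in>UNIV. \<Sum>c'\<in>UNIV. if c = c' then L $ i $ j * y $ j $ c' else 0)"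
      by (intro sum.cong refl) (simp add: mat_def)
    finally show ?thesis by simp
  qed
  then show ?thesis
    by (simp add: vec_eq_iff matrix_vector_mult_def kronecker_def flatten_def block_mult_def)
qed

lemma transpose_kronecker_mat1:
  "transpose L = L \<Longrightarrow> transpose (kronecker L (mat 1 :: real^'m^'m)) = kronecker L (mat 1)"
  by (simp add: vec_eq_iff transpose_def kronecker_def mat_def)

lemma linear_flatten: "linear flatten"
  by (rule linearI) (simp_all add: flatten_def vec_eq_iff)

lemma block_mult_ones: "block_mult (\<chi> i j. 1) y = real CARD('n) *\<^sub>R stacked_mean y"
  for y :: "real^'m^'n"
  by (simp add: block_mult_def stacked_mean_def agent_mean_def vec_eq_iff)

text \<open>The matrix on the right is symmetric, and the isometry \<open>flatten\<close> identifies
  it with the map on the left; the normalised all-ones block becomes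
  \<open>stacked_mean\<close>.\<close>

lemma consensus_norm_le:
  fixes y :: "real^'m^'n"
  assumes "transpose L = L"
  shows "norm (y - \<beta> *\<^sub>R block_mult L y - stacked_mean y) \<le> spectral_radius
      (mat 1 - \<beta> *\<^sub>R kronecker L (mat 1 :: real^'m^'m)
        - (1 / real CARD('n)) *\<^sub>R kronecker ((\<chi> i j. 1) :: real^'n^'n) (mat 1 :: real^'m^'m)) * norm y"
    (is "_ \<le> spectral_radius ?M * _")
proof -
  have "transpose ?M = ?M"
    using transpose_kronecker_mat1[OF assms, where 'm = 'm]
      transpose_kronecker_mat1[of "(\<chi> i j. 1) :: real^'n^'n", where 'm = 'm]
    by (simp add: vec_eq_iff transpose_def mat_def)
  moreover have "?M *v flatten y = flatten (y - \<beta> *\<^sub>R block_mult L y - stacked_mean y)"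
    by (simp add: matrix_vector_mult_diff_rdistrib scaleR_matrix_vector_assoc[symmetric]
      kronecker_mat1_flatten block_mult_ones linear_diff[OF linear_flatten] linear_scale[OF linear_flatten])
  ultimately show ?thesis
    using symmetric_norm_le_spectral_radius[of ?M "flatten y"] by (simp add: norm_flatten)
qed

section \<open>The Laplacian on stacked vectors\<close>

lemma laplacian_row_sum: "(\<Sum>j\<in>UNIV. laplacian A $ i $ j) = 0"
  by (simp add: laplacian_def sum_subtractf weighted_degree_def)

lemma transpose_laplacian:
  assumes "transpose A = A" shows "transpose (laplacian A) = laplacian A"
  using assms by (simp add: transpose_def laplacian_def vec_eq_iff)

lemma block_mult_stacked_mean: "block_mult (laplacian A) (stacked_mean y) = 0"
  by (simp add: block_mult_def stacked_mean_def vec_eq_iff sum_distrib_right[symmetric] laplacian_row_sum)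

lemma block_mult_deviation: "block_mult (laplacian A) y = block_mult (laplacian A) (y - stacked_mean y)"
  by (simp add: block_mult_simps block_mult_stacked_mean)

lemma stacked_mean_block_mult:
  assumes "transpose A = A" shows "stacked_mean (block_mult (laplacian A) y) = 0"
proof -
  have "laplacian A $ i $ j = laplacian A $ j $ i" for i j
    using transpose_laplacian[OF assms] by (simp add: transpose_def vec_eq_iff)
  then have col: "(\<Sum>i\<in>UNIV. laplacian A $ i $ j) = 0" for j
    using laplacian_row_sum[of A j] by simp
  have "(\<Sum>i\<in>UNIV. block_mult (laplacian A) y $ i) = (\<Sum>j\<in>UNIV. \<Sum>i\<in>UNIV. laplacian A $ i $ j *\<^sub>R y $ j)"
    unfolding block_mult_def by (simp, rule sum.swap)
  also have "\<dots> = 0" by (simp add: scaleR_sum_left[symmetric] col)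
  finally show ?thesis by (simp add: stacked_mean_def agent_mean_def vec_eq_iff)
qed

text \<open>The degree term and the adjacency terms of a row contribute at most one weighted degree
  each. Keeping them apart makes self-loops harmless.\<close>

lemma block_mult_laplacian_entry_le:
  assumes nonneg: "\<And>i j. 0 \<le> A $ i $ j" and r: "\<And>i c. \<bar>e $ i $ c\<bar> \<le> r"
  shows "\<bar>block_mult (laplacian A) e $ i $ c\<bar> \<le> 2 * max_degree A * r"
proof -
  have r0: "0 \<le> r" using r[of i c] by linarith
  have "block_mult (laplacian A) e $ i $ c = (\<Sum>j\<in>UNIV. laplacian A $ i $ j * e $ j $ c)"
    by (simp add: block_mult_def)
  also have "\<dots> = (\<Sum>j\<in>UNIV. (if i = j then weighted_degree A i * e $ j $ c else 0) - A $ i $ j * e $ j $ c)"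
    by (intro sum.cong) (auto simp: laplacian_def left_diff_distrib)
  also have "\<dots> = weighted_degree A i * e $ i $ c - (\<Sum>j\<in>UNIV. A $ i $ j * e $ j $ c)"
    by (simp add: sum_subtractf)
  finally have eq: "block_mult (laplacian A) e $ i $ c = \<dots>" .
  have wd: "0 \<le> weighted_degree A i" by (simp add: weighted_degree_def nonneg sum_nonneg)
  have "\<bar>weighted_degree A i * e $ i $ c\<bar> \<le> weighted_degree A i * r"
    using wd r by (simp add: abs_mult mult_left_mono)
  moreover have "\<bar>\<Sum>j\<in>UNIV. A $ i $ j * e $ j $ c\<bar> \<le> (\<Sum>j\<in>UNIV. A $ i $ j * r)"
    by (rule order_trans[OF sum_abs]) (intro sum_mono, simp add: abs_mult nonneg r mult_left_mono)
  moreover have "(\<Sum>j\<in>UNIV. A $ i $ j * r) = weighted_degree A i * r"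
    by (simp add: weighted_degree_def sum_distrib_right)
  ultimately have "\<bar>block_mult (laplacian A) e $ i $ c\<bar> \<le> 2 * weighted_degree A i * r"
    unfolding eq by linarith
  also have "\<dots> \<le> 2 * max_degree A * r"
    using r0 unfolding max_degree_def by (intro mult_right_mono mult_left_mono Max_ge) auto
  finally show ?thesis .
qed

text \<open>Opposite values at two agents form a vector with mean zero, on which the map cannot
  contract better than \<open>1 - b\<close>. Since \<open>b < sqrt 2 / 2\<close>, this keeps
  \<open>varrho\<close> away from 0, and the numerical margins of the scalar recursion rest on
  that.\<close>

lemma consensus_rate_ge:
  fixes L :: "real^'n^'n"
  assumes card: "CARD('n) \<ge> 2"
    and contr: "\<And>y :: real^'m^'n. norm (y - \<beta> *\<^sub>R block_mult L y - stacked_mean y) \<le> \<rho> * norm y"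
    and bound: "\<And>y :: real^'m^'n. norm (\<beta> *\<^sub>R block_mult L y) \<le> b * norm y"
  shows "1 - b \<le> \<rho>"
proof -
  obtain i j :: 'n where "i \<noteq> j"
  proof -
    have "\<not> is_singleton (UNIV :: 'n set)" using card by (simp add: is_singleton_altdef)
    then show thesis using that by (metis UNIV_I UNIV_eq_I empty_not_UNIV is_singletonI')
  qed
  obtain e :: "real^'m" where e: "norm e = 1" using vector_choose_size[of 1] by auto
  define y where "y = axis i e - axis j e"
  have "agent_mean y = 0"
    by (simp add: agent_mean_def y_def sum_subtractf axis_def)
  then have m: "stacked_mean y = 0" by (simp add: stacked_mean_def vec_eq_iff)
  have "y $ i = e" using \<open>i \<noteq> j\<close> by (simp add: y_def axis_def)
  then have "y \<noteq> 0" using e by auto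
  have "norm y \<le> norm (y - \<beta> *\<^sub>R block_mult L y) + norm (\<beta> *\<^sub>R block_mult L y)"
    by (metis norm_triangle_ineq diff_add_cancel)
  also have "\<dots> \<le> \<rho> * norm y + b * norm y"
    using contr[of y] bound[of y] by (simp add: m)
  finally have "1 * norm y \<le> (\<rho> + b) * norm y" by (simp add: algebra_simps)
  then show ?thesis using \<open>y \<noteq> 0\<close> by (simp only: mult_le_cancel_right) auto
qed

section \<open>Quantization\<close>

lemma quantizer_pos_error:
  assumes "- (1 / 2) < a" "a \<le> real K + 1 / 2"
  shows "\<bar>a - quantizer_pos K a\<bar> \<le> 1 / 2"
proof -
  \<comment> \<open>Quantization cells are open on the left and closed on the right, hence the
    ceiling.\<close>
  define l where "l = \<lceil>a - 1 / 2\<rceil>"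
  define j where "j = nat l"
  have l: "of_int l - 1 < a - 1 / 2 \<and> a - 1 / 2 \<le> of_int l"
    unfolding l_def by (rule ceiling_correct)
  then have "0 \<le> l" using assms(1) by linarith
  then have j: "real j = of_int l" by (simp add: j_def)
  have P: "(2 * real j - 1) / 2 < a" "a \<le> (2 * real j + 1) / 2"
    using l unfolding j by (simp_all add: field_simps)
  have "real j < real K + 1" using P assms(2) by (simp add: field_simps)
  then have "j \<le> K" by linarith
  then have "(THE j. j \<le> K \<and> (2 * real j - 1) / 2 < a \<and> a \<le> (2 * real j + 1) / 2) = j"
    using P by (intro the_equality) auto
  then have "quantizer_pos K a = real j" using assms(2) by (simp add: quantizer_pos_def)
  moreover have "\<bar>a - real j\<bar> \<le> 1 / 2" unfolding abs_le_iff using P by (simp add: field_simps)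
  ultimately show ?thesis by simp
qed

lemma quantizer_error:
  assumes "\<bar>a\<bar> \<le> real K + 1 / 2"
  shows "\<bar>a - quantizer K a\<bar> \<le> 1 / 2"
proof (cases "a \<le> - (1 / 2)")
  case True
  then have "\<bar>- a - quantizer_pos K (- a)\<bar> \<le> 1 / 2" using assms by (intro quantizer_pos_error) auto
  then have "\<bar>a - - quantizer_pos K (- a)\<bar> \<le> 1 / 2" by linarith
  then show ?thesis using True by (simp add: quantizer_def)
next
  case False
  then show ?thesis using quantizer_pos_error[of a K] assms by (simp add: quantizer_def)
qed

lemma decoder_encoder: "decoder s (encoder_out s K C) k = encoder_state s K C k"
  by (induction k) simp_all

text \<open>The quantizer sees the new value relative to the old estimate in units of
  \<open>s k\<close>. Inputs up to \<open>K + 1 / 2\<close> do not saturate, and rounding then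
  leaves at most half a unit.\<close>

lemma decoder_error:
  fixes C :: "nat \<Rightarrow> real^'m"
  assumes s: "0 < s k"
    and bound: "\<bar>(C (Suc k) - decoder s (encoder_out s K C) k) $ c\<bar> \<le> (real K + 1 / 2) * s k"
  shows "\<bar>(C (Suc k) - decoder s (encoder_out s K C) (Suc k)) $ c\<bar> \<le> s k / 2"
proof -
  define a where "a = (C (Suc k) - encoder_state s K C k) $ c"
  have "\<bar>a\<bar> \<le> (real K + 1 / 2) * s k" using bound by (simp add: a_def decoder_encoder)
  then have "\<bar>1 / s k * a\<bar> \<le> real K + 1 / 2" using s by (simp add: abs_mult pos_divide_le_eq)
  then have "\<bar>1 / s k * a - quantizer K (1 / s k * a)\<bar> * s k \<le> 1 / 2 * s k"
    using quantizer_error s by (intro mult_right_mono) auto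
  moreover have "a - s k * quantizer K (1 / s k * a) = (1 / s k * a - quantizer K (1 / s k * a)) * s k"
    using s by (simp add: left_diff_distrib)
  moreover have "(C (Suc k) - decoder s (encoder_out s K C) (Suc k)) $ c = a - s k * quantizer K (1 / s k * a)"
    by (simp add: a_def decoder_encoder quantizer_vec_def)
  ultimately show ?thesis using s by (simp add: abs_mult)
qed

lemma entry_le_infnorm: "\<bar>y $ i $ c\<bar> \<le> infnorm y" for y :: "real^'m^'n"
proof -
  have "axis i (axis c 1) \<in> (Basis :: (real^'m^'n) set)" by (simp add: axis_in_Basis_iff)
  then show ?thesis using Basis_le_infnorm[of "axis i (axis c 1)" y] by (simp add: inner_axis)
qed

lemma entry_le_norm: "\<bar>y $ i $ c\<bar> \<le> norm y" for y :: "real^'m^'n"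
  by (rule order_trans[OF component_le_norm_cart Finite_Cartesian_Product.norm_nth_le])

lemma norm_le_entries:
  fixes y :: "real^'m^'n"
  assumes "\<And>i c. \<bar>y $ i $ c\<bar> \<le> r"
  shows "(norm y)\<^sup>2 \<le> real CARD('n) * real CARD('m) * r\<^sup>2"
proof -
  have "(y $ i $ c)\<^sup>2 \<le> r\<^sup>2" for i c using assms[of i c] by (simp add: abs_le_square_iff[symmetric])
  then have "(\<Sum>i\<in>UNIV. \<Sum>c\<in>UNIV. (y $ i $ c)\<^sup>2) \<le> (\<Sum>i\<in>(UNIV :: 'n set). \<Sum>c\<in>(UNIV :: 'm set). r\<^sup>2)"
    by (intro sum_mono)
  moreover have "(norm y)\<^sup>2 = (\<Sum>i\<in>UNIV. \<Sum>c\<in>UNIV. (y $ i $ c)\<^sup>2)"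
    by (simp add: norm_sq_vec) (simp add: norm_vec_def L2_set_def sum_nonneg)
  ultimately show ?thesis by simp
qed

section \<open>One iteration of the algorithm\<close>

text \<open>\<open>rho\<close> and \<open>b\<close> stand for \<open>varrho\<close> and
  \<open>\<beta> * rhoL\<close>; the spectral radii enter through the norm bounds
  \<open>contraction\<close> and \<open>laplacian_bound\<close>.\<close>

locale gradient_tracking_run =
  fixes A :: "real^'n^'n" and f :: "'n \<Rightarrow> real^'m \<Rightarrow> real" and s :: "nat \<Rightarrow> real" and K :: nat
    and x u xhat uhat :: "nat \<Rightarrow> real^'m^'n"
    and Lf \<nu> fstar \<beta> \<delta> rho b :: real
  assumes symmetric: "transpose A = A" and A_nonneg: "\<And>i j. 0 \<le> A $ i $ j"
    and differentiable: "\<And>i y. f i differentiable (at y)"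
    and Lf_pos: "Lf > 0"
    and smooth: "\<And>i y z. norm (grad (f i) y - grad (f i) z) \<le> Lf * norm (y - z)"
    and minimum: "\<And>y. fstar \<le> avg_objective f y"
    and PL: "\<And>y. \<nu> * (avg_objective f y - fstar) \<le> 1 / 2 * (norm (grad (avg_objective f) y))\<^sup>2"
    and run: "quantized_gradient_tracking f A \<beta> \<delta> s K x u xhat uhat"
    and beta_pos: "0 < \<beta>" and delta_pos: "0 < \<delta>" and b_nonneg: "0 \<le> b"
    and contraction: "\<And>y :: real^'m^'n. norm (y - \<beta> *\<^sub>R block_mult (laplacian A) y - stacked_mean y) \<le> rho * norm y"
    and laplacian_bound: "\<And>y :: real^'m^'n. norm (\<beta> *\<^sub>R block_mult (laplacian A) y) \<le> b * norm y"
begin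

definition gradF :: "real^'m^'n \<Rightarrow> real^'m^'n" where
  "gradF y = (\<chi> i. grad (f i) (y $ i))"

abbreviation dev :: "real^'m^'n \<Rightarrow> real^'m^'n" where
  "dev y \<equiv> y - stacked_mean y"

definition "ex k = x k - xhat k"
definition "eu k = u k - uhat k"
definition "X k = (norm (dev (x k)))\<^sup>2"
definition "U k = (norm (dev (u k)))\<^sup>2"
text \<open>\<open>U\<close> and \<open>N\<close> split the squared norm of \<open>u k\<close> into
  disagreement and mean. \<open>N\<close> gets no recursion of its own; it is bounded through
  \<open>descent\<close>.\<close>

definition "N k = (norm (stacked_mean (u k)))\<^sup>2"
definition "G k = real CARD('n) * (avg_objective f (agent_mean (x k)) - fstar)"

section \<open>Averaged gradients and descent of the optimality gap\<close>

lemma gradF_lipschitz: "(norm (gradF y - gradF z))\<^sup>2 \<le> Lf\<^sup>2 * (norm (y - z))\<^sup>2"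
proof -
  have "(norm (grad (f i) (y $ i) - grad (f i) (z $ i)))\<^sup>2 \<le> Lf\<^sup>2 * (norm (y $ i - z $ i))\<^sup>2" for i
    using power_mono[OF smooth norm_ge_zero, of i "y $ i" "z $ i" 2] by (simp add: power_mult_distrib)
  then show ?thesis by (simp add: norm_sq_vec gradF_def sum_distrib_left sum_mono)
qed

lemma norm_gradF_lipschitz: "norm (gradF y - gradF z) \<le> Lf * norm (y - z)"
  by (rule power2_le_imp_le) (use gradF_lipschitz Lf_pos in \<open>auto simp: power_mult_distrib\<close>)

lemma mean_gradF_lipschitz:
  "real CARD('n) * (norm (agent_mean (gradF y) - agent_mean (gradF z)))\<^sup>2 \<le> Lf\<^sup>2 * (norm (y - z))\<^sup>2"
  using norm_agent_mean_sq_le[of "gradF y - gradF z"] gradF_lipschitz[of y z]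
  by (simp add: linear_diff[OF linear_agent_mean])

lemma avg_objective_derivative:
  "(avg_objective f has_derivative (\<lambda>h. h \<bullet> agent_mean (gradF (\<chi> i. y)))) (at y)"
  using has_derivative_avg_objective[of f, OF differentiable] by (simp add: agent_mean_def gradF_def)

lemma grad_avg_objective: "grad (avg_objective f) y = agent_mean (gradF (\<chi> i. y))"
  by (rule grad_eqI[OF avg_objective_derivative])

lemma mean_gradient_lipschitz:
  "norm (agent_mean (gradF (\<chi> i. y)) - agent_mean (gradF (\<chi> i. z))) \<le> Lf * norm (y - z)"
proof -
  have "(norm ((\<chi> i. y) - (\<chi> i. z) :: real^'m^'n))\<^sup>2 = real CARD('n) * (norm (y - z))\<^sup>2"
    by (simp add: norm_sq_vec)
  then have "real CARD('n) * (norm (agent_mean (gradF (\<chi> i. y)) - agent_mean (gradF (\<chi> i. z))))\<^sup>2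
      \<le> real CARD('n) * (Lf * norm (y - z))\<^sup>2"
    using mean_gradF_lipschitz[of "\<chi> i. y" "\<chi> i. z"] by (simp add: power_mult_distrib mult_ac)
  then show ?thesis using Lf_pos by (auto intro: power2_le_imp_le)
qed

lemma objective_descent:
  "avg_objective f (y - \<delta> *\<^sub>R w) - fstar + \<delta> / 2 * (1 - \<delta> * Lf) * (norm w)\<^sup>2
    \<le> (1 - \<delta> * \<nu>) * (avg_objective f y - fstar) + \<delta> / 2 * (norm (agent_mean (gradF (\<chi> i. y)) - w))\<^sup>2"
  using PL[of y] delta_pos
  by (intro inexact_gradient_descent avg_objective_derivative mean_gradient_lipschitz)
    (auto simp: grad_avg_objective)

lemma x_Suc: "x (Suc k) = x k - \<beta> *\<^sub>R block_mult (laplacian A) (x k - ex k) + - \<delta> *\<^sub>R u k"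
  using run by (simp add: quantized_gradient_tracking_def vec_eq_iff block_mult_def ex_def)

lemma u_Suc: "u (Suc k) = u k - \<beta> *\<^sub>R block_mult (laplacian A) (u k - eu k) + (gradF (x (Suc k)) - gradF (x k))"
  using run by (simp add: quantized_gradient_tracking_def vec_eq_iff block_mult_def eu_def gradF_def)

lemma u_0: "u 0 = gradF (x 0)"
  using run by (simp add: quantized_gradient_tracking_def vec_eq_iff gradF_def)

lemma hat_0: "xhat 0 = 0" "uhat 0 = 0"
  using run by (simp_all add: quantized_gradient_tracking_def vec_eq_iff)

lemma x_1: "x 1 = x 0 + - \<delta> *\<^sub>R u 0"
  using x_Suc[of 0] by (simp add: ex_def hat_0 block_mult_simps)

lemma u_1: "u 1 = u 0 + (gradF (x 1) - gradF (x 0))"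
  using u_Suc[of 0] by (simp add: eu_def hat_0 block_mult_simps)

lemma agent_mean_block_mult: "agent_mean (block_mult (laplacian A) y) = 0" for y :: "real^'m^'n"
  using stacked_mean_block_mult[OF symmetric, of y] by (simp add: stacked_mean_def vec_eq_iff)

lemmas agent_mean_simps = linear_add[OF linear_agent_mean] linear_diff[OF linear_agent_mean]
  linear_scale[OF linear_agent_mean] agent_mean_block_mult

text \<open>Tracking invariant: the Laplacian has zero column sums, so averaging removes the
  consensus terms together with all quantization errors, and the gradient increments
  telescope.\<close>

lemma agent_mean_u: "agent_mean (u k) = agent_mean (gradF (x k))"
proof (induction k)
  case 0
  then show ?case by (simp add: u_0)
next
  case (Suc k)
  then show ?case unfolding u_Suc[of k] by (simp only: agent_mean_simps) simp
qed

lemma agent_mean_x_Suc: "agent_mean (x (Suc k)) = agent_mean (x k) - \<delta> *\<^sub>R agent_mean (u k)"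
  unfolding x_Suc[of k] by (simp only: agent_mean_simps) simp

lemma G_nonneg: "0 \<le> G k"
  using minimum by (simp add: G_def)

text \<open>By the tracking invariant the mean of the trackers differs from the gradient of
  \<open>f\<close> at the mean state only through disagreement, which costs
  \<open>Lf\<^sup>2 * X k\<close>. Means do not see the quantization, so no noise occurs
  here.\<close>

lemma descent:
  "G (Suc k) + \<delta> / 2 * (1 - \<delta> * Lf) * N k \<le> (1 - \<delta> * \<nu>) * G k + \<delta> / 2 * Lf\<^sup>2 * X k"
proof -
  let ?n = "real CARD('n)" and ?y = "agent_mean (x k)" and ?w = "agent_mean (u k)"
  have "?n * (avg_objective f (?y - \<delta> *\<^sub>R ?w) - fstar + \<delta> / 2 * (1 - \<delta> * Lf) * (norm ?w)\<^sup>2)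
    \<le> ?n * ((1 - \<delta> * \<nu>) * (avg_objective f ?y - fstar)
        + \<delta> / 2 * (norm (agent_mean (gradF (\<chi> i. ?y)) - ?w))\<^sup>2)"
    by (intro mult_left_mono objective_descent) simp
  then have "G (Suc k) + \<delta> / 2 * (1 - \<delta> * Lf) * N k \<le> (1 - \<delta> * \<nu>) * G k
      + \<delta> / 2 * (?n * (norm (agent_mean (gradF (\<chi> i. ?y)) - ?w))\<^sup>2)"
    by (simp add: G_def N_def norm_stacked_mean agent_mean_x_Suc algebra_simps)
  also have "?n * (norm (agent_mean (gradF (\<chi> i. ?y)) - ?w))\<^sup>2 \<le> Lf\<^sup>2 * X k"
    using mean_gradF_lipschitz[of "stacked_mean (x k)" "x k"]
    by (simp add: X_def agent_mean_u stacked_mean_def norm_minus_commute)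
  finally show ?thesis using delta_pos by (simp add: mult_left_mono mult_ac)
qed

text \<open>If the gap were positive, an exact gradient step would lead below \<open>fstar\<close>,
  since its factor \<open>1 - \<delta> * \<nu>\<close> is negative.\<close>

lemma G_zero:
  assumes "1 < \<delta> * \<nu>" "\<delta> * Lf \<le> 1" shows "G k = 0"
proof -
  let ?y = "agent_mean (x k)"
  let ?w = "agent_mean (gradF (\<chi> i. ?y))"
  have "0 \<le> \<delta> / 2 * (1 - \<delta> * Lf) * (norm ?w)\<^sup>2" using delta_pos assms(2) by simp
  then have "0 \<le> (1 - \<delta> * \<nu>) * (avg_objective f ?y - fstar)"
    using objective_descent[of ?y ?w] minimum[of "?y - \<delta> *\<^sub>R ?w"] by simp
  then have "avg_objective f ?y - fstar \<le> 0" using assms(1) by (simp add: zero_le_mult_iff)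
  then show ?thesis using minimum[of ?y] by (simp add: G_def)
qed

text \<open>Common form of both updates: \<open>g\<close> is \<open>- \<delta> *\<^sub>R u k\<close>
  for the states and the gradient increment for the trackers.\<close>

lemma deviation_step:
  assumes y': "y' = y - \<beta> *\<^sub>R block_mult (laplacian A) (y - e) + g" and t: "0 < t"
  shows "(norm (dev y'))\<^sup>2 \<le> (1 + t) * rho\<^sup>2 * (norm (dev y))\<^sup>2
    + (1 + 1 / t) * (2 * b\<^sup>2 * (norm e)\<^sup>2 + 2 * (norm (dev g))\<^sup>2)"
proof -
  let ?L = "block_mult (laplacian A)"
  \<comment> \<open>The last term is zero; it brings the contracted part into the shape of
    \<open>contraction\<close>.\<close>
  define p where "p = dev y - \<beta> *\<^sub>R ?L (dev y) - stacked_mean (dev y)"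
  define r where "r = \<beta> *\<^sub>R ?L e + dev g"
  have "dev y' = p + r"
    unfolding y' p_def r_def block_mult_deviation[of A y, symmetric]
    by (simp add: stacked_mean_simps stacked_mean_idem block_mult_simps
        stacked_mean_block_mult[OF symmetric] algebra_simps)
  then have "(norm (dev y'))\<^sup>2 \<le> (1 + t) * (norm p)\<^sup>2 + (1 + 1 / t) * (norm r)\<^sup>2"
    using norm_add_sq_le[OF t, of p r] by simp
  also have "\<dots> \<le> (1 + t) * (rho * norm (dev y))\<^sup>2
      + (1 + 1 / t) * (2 * (b * norm e)\<^sup>2 + 2 * (norm (dev g))\<^sup>2)"
  proof (intro add_mono mult_left_mono)
    show "(norm p)\<^sup>2 \<le> (rho * norm (dev y))\<^sup>2"
      unfolding p_def by (intro power_mono contraction) simp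
    have "(norm (\<beta> *\<^sub>R ?L e))\<^sup>2 \<le> (b * norm e)\<^sup>2" by (intro power_mono laplacian_bound) simp
    then show "(norm r)\<^sup>2 \<le> 2 * (b * norm e)\<^sup>2 + 2 * (norm (dev g))\<^sup>2"
      using norm_add_sq_le2[of "\<beta> *\<^sub>R ?L e" "dev g"] unfolding r_def by linarith
  qed (use t in auto)
  finally show ?thesis by (simp add: power_mult_distrib mult_ac)
qed

lemma dev_scale: "dev (a *\<^sub>R y) = a *\<^sub>R dev y"
  by (simp add: stacked_mean_simps scaleR_diff_right)

lemma X_step:
  "0 < t \<Longrightarrow> X (Suc k) \<le> (1 + t) * rho\<^sup>2 * X k
    + (1 + 1 / t) * (2 * b\<^sup>2 * (norm (ex k))\<^sup>2 + 2 * \<delta>\<^sup>2 * U k)"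
  using deviation_step[OF x_Suc, of t k]
  unfolding dev_scale by (simp add: X_def U_def power_mult_distrib mult_ac)

lemma x_increment:
  "x (Suc k) - x k = (\<beta> *\<^sub>R block_mult (laplacian A) (ex k) - \<beta> *\<^sub>R block_mult (laplacian A) (dev (x k)))
    + (- \<delta> *\<^sub>R dev (u k) + - \<delta> *\<^sub>R stacked_mean (u k))"
  unfolding x_Suc[of k] block_mult_deviation[of A "x k", symmetric]
  by (simp add: block_mult_simps algebra_simps)

lemma norm_x_increment:
  "(norm (x (Suc k) - x k))\<^sup>2 \<le> 4 * (b\<^sup>2 * X k + b\<^sup>2 * (norm (ex k))\<^sup>2 + \<delta>\<^sup>2 * U k + \<delta>\<^sup>2 * N k)"
proof -
  let ?L = "\<lambda>y. \<beta> *\<^sub>R block_mult (laplacian A) y"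
  have L: "(norm (?L y))\<^sup>2 \<le> b\<^sup>2 * (norm y)\<^sup>2" for y :: "real^'m^'n"
    using power_mono[OF laplacian_bound norm_ge_zero, of y 2] by (simp add: power_mult_distrib)
  have "(norm (x (Suc k) - x k))\<^sup>2 \<le> 2 * (norm (?L (ex k) - ?L (dev (x k))))\<^sup>2
      + 2 * (norm (- \<delta> *\<^sub>R dev (u k) + - \<delta> *\<^sub>R stacked_mean (u k)))\<^sup>2"
    unfolding x_increment by (rule norm_add_sq_le2)
  moreover have "(norm (?L (ex k) - ?L (dev (x k))))\<^sup>2 \<le> 2 * (norm (?L (ex k)))\<^sup>2 + 2 * (norm (?L (dev (x k))))\<^sup>2"
    using norm_add_sq_le2[of "?L (ex k)" "- ?L (dev (x k))"] by simp
  moreover have "(norm (- \<delta> *\<^sub>R dev (u k) + - \<delta> *\<^sub>R stacked_mean (u k)))\<^sup>2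
      \<le> 2 * (\<delta>\<^sup>2 * U k) + 2 * (\<delta>\<^sup>2 * N k)"
    using norm_add_sq_le2[of "- \<delta> *\<^sub>R dev (u k)" "- \<delta> *\<^sub>R stacked_mean (u k)"]
    by (simp add: U_def N_def power_mult_distrib)
  ultimately show ?thesis using L[of "ex k"] L[of "dev (x k)"] unfolding X_def distrib_left by linarith
qed

lemma U_step:
  assumes "0 < t"
  shows "U (Suc k) \<le> (1 + t) * rho\<^sup>2 * U k + (1 + 1 / t) * (2 * b\<^sup>2 * (norm (eu k))\<^sup>2
    + 8 * Lf\<^sup>2 * (b\<^sup>2 * X k + b\<^sup>2 * (norm (ex k))\<^sup>2 + \<delta>\<^sup>2 * U k + \<delta>\<^sup>2 * N k))"
proof -
  let ?D = "gradF (x (Suc k)) - gradF (x k)"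
  have "(norm (dev ?D))\<^sup>2 \<le> Lf\<^sup>2 * (norm (x (Suc k) - x k))\<^sup>2"
    using norm_deviation_le[of ?D] gradF_lipschitz[of "x (Suc k)" "x k"] by linarith
  also have "\<dots> \<le> Lf\<^sup>2 * (4 * (b\<^sup>2 * X k + b\<^sup>2 * (norm (ex k))\<^sup>2 + \<delta>\<^sup>2 * U k + \<delta>\<^sup>2 * N k))"
    by (intro mult_left_mono norm_x_increment) simp
  finally have "(1 + 1 / t) * (2 * b\<^sup>2 * (norm (eu k))\<^sup>2 + 2 * (norm (dev ?D))\<^sup>2) \<le>
      (1 + 1 / t) * (2 * b\<^sup>2 * (norm (eu k))\<^sup>2
      + 8 * Lf\<^sup>2 * (b\<^sup>2 * X k + b\<^sup>2 * (norm (ex k))\<^sup>2 + \<delta>\<^sup>2 * U k + \<delta>\<^sup>2 * N k))"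
    using assms by (intro mult_left_mono add_left_mono) (auto simp: algebra_simps)
  then show ?thesis
    using deviation_step[OF u_Suc assms, of k] unfolding U_def by linarith
qed

lemma X_start:
  assumes "0 < t" shows "X 1 \<le> (1 + t) * X 0 + (1 + 1 / t) * (\<delta>\<^sup>2 * U 0)"
proof -
  have "dev (x 1) = dev (x 0) + - \<delta> *\<^sub>R dev (u 0)"
    unfolding x_1 by (simp add: stacked_mean_simps algebra_simps)
  then show ?thesis using norm_add_sq_le[OF assms, of "dev (x 0)" "- \<delta> *\<^sub>R dev (u 0)"]
    by (simp add: X_def U_def power_mult_distrib)
qed

lemma U_start:
  assumes "0 < t" shows "U 1 \<le> (1 + t) * U 0 + (1 + 1 / t) * (\<delta>\<^sup>2 * Lf\<^sup>2 * (U 0 + N 0))"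
proof -
  let ?D = "gradF (x 1) - gradF (x 0)"
  have "(norm (dev ?D))\<^sup>2 \<le> Lf\<^sup>2 * (norm (x 1 - x 0))\<^sup>2"
    using norm_deviation_le[of ?D] gradF_lipschitz[of "x 1" "x 0"] by linarith
  \<comment> \<open>The first displacement is exactly \<open>- \<delta> *\<^sub>R u 0\<close>, so
    the factor 4 of \<open>norm_x_increment\<close> is avoided.\<close>
  also have "\<dots> = \<delta>\<^sup>2 * Lf\<^sup>2 * (U 0 + N 0)"
    unfolding x_1 U_def N_def norm_sq_mean_decomposition[of "u 0", symmetric]
    by (simp add: power_mult_distrib)
  finally have "(1 + 1 / t) * (norm (dev ?D))\<^sup>2 \<le> (1 + 1 / t) * (\<delta>\<^sup>2 * Lf\<^sup>2 * (U 0 + N 0))"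
    using assms by (intro mult_left_mono) auto
  moreover have "dev (u 1) = dev (u 0) + dev ?D"
    unfolding u_1 by (simp add: stacked_mean_simps algebra_simps)
  ultimately show ?thesis using norm_add_sq_le[OF assms, of "dev (u 0)" "dev ?D"]
    unfolding U_def by simp
qed

text \<open>Entrywise, because saturation is decided coordinate by coordinate.\<close>

definition precise :: "nat \<Rightarrow> real \<Rightarrow> bool" where
  "precise k r \<longleftrightarrow> (\<forall>i c. \<bar>ex k $ i $ c\<bar> \<le> r \<and> \<bar>eu k $ i $ c\<bar> \<le> r)"

lemma precise_Suc:
  assumes "0 < s k"
    and "\<And>i c. \<bar>(x (Suc k) - xhat k) $ i $ c\<bar> \<le> (real K + 1 / 2) * s k"
    and "\<And>i c. \<bar>(u (Suc k) - uhat k) $ i $ c\<bar> \<le> (real K + 1 / 2) * s k"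
  shows "precise (Suc k) (s k / 2)"
proof -
  have hat: "xhat k $ i = decoder s (encoder_out s K (\<lambda>t. x t $ i)) k"
    "uhat k $ i = decoder s (encoder_out s K (\<lambda>t. u t $ i)) k" for k i
    using run by (auto simp: quantized_gradient_tracking_def)
  show ?thesis
    unfolding precise_def ex_def eu_def
    using decoder_error[of s k "\<lambda>t. x t $ i" for i, OF assms(1)]
      decoder_error[of s k "\<lambda>t. u t $ i" for i, OF assms(1)] assms(2,3)
    by (simp add: hat)
qed

lemma precise_norm:
  assumes "precise k r" "0 \<le> r"
  shows "(norm (ex k))\<^sup>2 \<le> real CARD('n) * real CARD('m) * r\<^sup>2"
    and "(norm (eu k))\<^sup>2 \<le> real CARD('n) * real CARD('m) * r\<^sup>2"
    and "norm (ex k) \<le> sqrt (real CARD('n) * real CARD('m)) * r"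
proof -
  show x: "(norm (ex k))\<^sup>2 \<le> real CARD('n) * real CARD('m) * r\<^sup>2"
    using assms by (intro norm_le_entries) (auto simp: precise_def)
  show "(norm (eu k))\<^sup>2 \<le> real CARD('n) * real CARD('m) * r\<^sup>2"
    using assms by (intro norm_le_entries) (auto simp: precise_def)
  show "norm (ex k) \<le> sqrt (real CARD('n) * real CARD('m)) * r"
    by (rule power2_le_imp_le) (use x assms in \<open>auto simp: power_mult_distrib\<close>)
qed

text \<open>Contributions of the estimation error are bounded in the maximum norm, which gives the
  degree term of \<open>theta1\<close>. For the rest, Euclidean bounds are available and an entry is
  at most the norm.\<close>

lemma quantizer_input_x:
  assumes "precise k r" "norm (dev (x k)) \<le> T" "norm (dev (u k)) \<le> T" "norm (stacked_mean (u k)) \<le> w"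
  shows "\<bar>(x (Suc k) - xhat k) $ i $ c\<bar> \<le> (1 + 2 * \<beta> * max_degree A) * r + (b * T + \<delta> * T + \<delta> * w)"
proof -
  let ?L = "\<lambda>y. \<beta> *\<^sub>R block_mult (laplacian A) y"
  let ?v = "- ?L (dev (x k)) + - \<delta> *\<^sub>R u k"
  have eq: "x (Suc k) - xhat k = ex k + ?L (ex k) + ?v"
    unfolding x_Suc[of k] block_mult_deviation[of A "x k", symmetric]
    by (simp add: block_mult_simps ex_def algebra_simps)
  have "\<bar>block_mult (laplacian A) (ex k) $ i $ c\<bar> \<le> 2 * max_degree A * r"
    using assms(1) by (intro block_mult_laplacian_entry_le A_nonneg) (auto simp: precise_def)
  then have "\<beta> * \<bar>block_mult (laplacian A) (ex k) $ i $ c\<bar> \<le> \<beta> * (2 * max_degree A * r)"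
    using beta_pos by (intro mult_left_mono) auto
  then have l: "\<bar>?L (ex k) $ i $ c\<bar> \<le> 2 * \<beta> * max_degree A * r"
    using beta_pos by (simp add: abs_mult)
  have e: "\<bar>ex k $ i $ c\<bar> \<le> r" using assms(1) by (auto simp: precise_def)
  have "norm (?L (dev (x k))) \<le> b * T"
    using laplacian_bound[of "dev (x k)"] mult_left_mono[OF assms(2) b_nonneg] by linarith
  moreover have "norm (u k) \<le> T + w"
    using norm_triangle_ineq[of "dev (u k)" "stacked_mean (u k)"] assms(3,4) by simp
  then have "norm (- \<delta> *\<^sub>R u k) \<le> \<delta> * (T + w)" using delta_pos by simp
  ultimately have "norm ?v \<le> b * T + \<delta> * (T + w)"
    using norm_triangle_ineq[of "- ?L (dev (x k))" "- \<delta> *\<^sub>R u k"] by simp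
  then have v: "\<bar>?v $ i $ c\<bar> \<le> b * T + \<delta> * (T + w)" using entry_le_norm[of ?v i c] by linarith
  have "\<bar>(x (Suc k) - xhat k) $ i $ c\<bar> \<le> \<bar>ex k $ i $ c\<bar> + \<bar>?L (ex k) $ i $ c\<bar> + \<bar>?v $ i $ c\<bar>"
    unfolding eq vector_add_component by linarith
  also have "\<dots> \<le> r + 2 * \<beta> * max_degree A * r + (b * T + \<delta> * (T + w))"
    using e l v by (intro add_mono)
  finally show ?thesis by (simp add: algebra_simps)
qed

text \<open>The gradient increment depends on the displacement of the states, so the estimation
  error enters a second time, now by its Euclidean norm \<open>e\<close>. This is the origin of the
  \<open>sqrt nm\<close> term in \<open>theta2\<close>.\<close>

lemma quantizer_input_u:
  assumes "precise k r" "norm (dev (x k)) \<le> T" "norm (dev (u k)) \<le> T" "norm (stacked_mean (u k)) \<le> w"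
    and ex: "norm (ex k) \<le> e"
  shows "\<bar>(u (Suc k) - uhat k) $ i $ c\<bar> \<le> (1 + 2 * \<beta> * max_degree A) * r
    + (b * T + Lf * (b * e + b * T + \<delta> * T + \<delta> * w))"
proof -
  let ?L = "\<lambda>y. \<beta> *\<^sub>R block_mult (laplacian A) y"
  let ?D = "gradF (x (Suc k)) - gradF (x k)"
  let ?v = "- ?L (dev (u k)) + ?D"
  have eq: "u (Suc k) - uhat k = eu k + ?L (eu k) + ?v"
    unfolding u_Suc[of k] block_mult_deviation[of A "u k", symmetric]
    by (simp add: block_mult_simps eu_def algebra_simps)
  have "\<bar>block_mult (laplacian A) (eu k) $ i $ c\<bar> \<le> 2 * max_degree A * r"
    using assms(1) by (intro block_mult_laplacian_entry_le A_nonneg) (auto simp: precise_def)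
  then have "\<beta> * \<bar>block_mult (laplacian A) (eu k) $ i $ c\<bar> \<le> \<beta> * (2 * max_degree A * r)"
    using beta_pos by (intro mult_left_mono) auto
  then have l: "\<bar>?L (eu k) $ i $ c\<bar> \<le> 2 * \<beta> * max_degree A * r"
    using beta_pos by (simp add: abs_mult)
  have e: "\<bar>eu k $ i $ c\<bar> \<le> r" using assms(1) by (auto simp: precise_def)
  have L: "norm (?L y) \<le> b * t" if "norm y \<le> t" for y :: "real^'m^'n" and t
    using laplacian_bound[of y] mult_left_mono[OF that b_nonneg] by linarith
  have "norm (x (Suc k) - x k) \<le> norm (?L (ex k)) + norm (?L (dev (x k)))
      + (norm (- \<delta> *\<^sub>R dev (u k)) + norm (- \<delta> *\<^sub>R stacked_mean (u k)))"
    unfolding x_increment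
    by (intro order_trans[OF norm_triangle_ineq] add_mono norm_triangle_ineq norm_triangle_ineq4)
  also have "\<dots> \<le> b * e + b * T + (\<delta> * T + \<delta> * w)"
    using delta_pos assms by (intro add_mono L) auto
  finally have "Lf * norm (x (Suc k) - x k) \<le> Lf * (b * e + b * T + (\<delta> * T + \<delta> * w))"
    using Lf_pos by (intro mult_left_mono) auto
  then have "norm ?D \<le> Lf * (b * e + b * T + (\<delta> * T + \<delta> * w))"
    using norm_gradF_lipschitz[of "x (Suc k)" "x k"] by linarith
  then have "norm ?v \<le> b * T + Lf * (b * e + b * T + (\<delta> * T + \<delta> * w))"
    using norm_triangle_ineq[of "- ?L (dev (u k))" ?D] L[OF assms(3)] by simp
  then have v: "\<bar>?v $ i $ c\<bar> \<le> b * T + Lf * (b * e + b * T + (\<delta> * T + \<delta> * w))"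
    using entry_le_norm[of ?v i c] by linarith
  have "\<bar>(u (Suc k) - uhat k) $ i $ c\<bar> \<le> \<bar>eu k $ i $ c\<bar> + \<bar>?L (eu k) $ i $ c\<bar> + \<bar>?v $ i $ c\<bar>"
    unfolding eq vector_add_component by linarith
  also have "\<dots> \<le> r + 2 * \<beta> * max_degree A * r + (b * T + Lf * (b * e + b * T + (\<delta> * T + \<delta> * w)))"
    using e l v by (intro add_mono)
  finally show ?thesis by (simp add: algebra_simps)
qed

text \<open>With zero estimates the first quantizer inputs are \<open>x 1\<close> and
  \<open>u 1\<close> themselves, and \<open>u 1\<close> is the gradient of the stacked objective at
  \<open>x 1\<close>. The first two lower bounds on \<open>s0\<close> keep both in range.\<close>

lemma precise_1:
  assumes "0 < s 0" "infnorm (x 0) \<le> Cx" "infnorm (u 0) \<le> Cu"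
    and "Cx + \<delta> * Cu \<le> (real K + 1 / 2) * s 0"
    and "infnorm (grad (stacked_objective f) (x 0 - \<delta> *\<^sub>R u 0)) \<le> (real K + 1 / 2) * s 0"
  shows "precise 1 (s 0 / 2)"
proof -
  have "precise (Suc 0) (s 0 / 2)"
  proof (rule precise_Suc)
    fix i c
    have "\<bar>x 0 $ i $ c\<bar> \<le> Cx" "\<bar>u 0 $ i $ c\<bar> \<le> Cu"
      using entry_le_infnorm assms(2,3) order_trans by blast+
    moreover from this(2) have "\<bar>\<delta> * u 0 $ i $ c\<bar> \<le> \<delta> * Cu"
      using delta_pos by (simp add: abs_mult)
    ultimately have "\<bar>x 0 $ i $ c - \<delta> * u 0 $ i $ c\<bar> \<le> (real K + 1 / 2) * s 0"
      using assms(4) by linarith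
    then show "\<bar>(x (Suc 0) - xhat 0) $ i $ c\<bar> \<le> (real K + 1 / 2) * s 0"
      using x_1 by (simp add: hat_0)
    have "grad (stacked_objective f) (x 0 - \<delta> *\<^sub>R u 0) = u 1"
    proof -
      have "x 0 - \<delta> *\<^sub>R u 0 = x 1" unfolding x_1 by simp
      then show ?thesis
        unfolding grad_stacked_objective[OF differentiable] u_1 u_0 by (simp add: gradF_def)
    qed
    then show "\<bar>(u (Suc 0) - uhat 0) $ i $ c\<bar> \<le> (real K + 1 / 2) * s 0"
      using entry_le_infnorm[of "u 1" i c] assms(5) by (simp add: hat_0)
  qed (rule assms)
  then show ?thesis by simp
qed

end

section \<open>The scalar recursion\<close>

text \<open>\<open>p\<close>, \<open>q\<close>, \<open>z\<close> are \<open>varrho\<^sup>2\<close>,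
  \<open>1 + 1 / sigma1\<close>, \<open>\<mu>\<^sup>2\<close>; \<open>v1\<close>, \<open>v2\<close>,
  \<open>v3\<close> are the entries of \<open>zeta\<close> and \<open>lam\<close> is its eigenvalue.
  Young's inequality with parameter \<open>sigma1\<close> turns the contraction factor
  \<open>p\<close> into \<open>(1 + p) / 2\<close>, halfway between \<open>p\<close> and 1.\<close>

locale tracking_gains =
  fixes b \<delta> Lf \<nu> p c2 c1 Theta1 Theta2 rhobar q :: real
    and chi1 chi2 chi3 chi4 chi5 chi6 chi7 :: real
    and lam v1 v2 v3 vmin vmax z :: real
  assumes b_pos: "0 < b" and b_less: "b < sqrt 2 / 2" and p_ge: "(1 - b)\<^sup>2 \<le> p"
    and Lf_pos: "0 < Lf" and nu_pos: "0 < \<nu>"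
    and c2_pos: "0 < c2" and c2_less: "c2 < 1 - p"
    and c1_eq: "c1 = (1 - p - c2) * (1 - p) / (1 + p)"
    and Theta2_eq: "Theta2 = c1 / (32 * Lf\<^sup>2)"
    and Theta1_eq: "Theta1 = min (c1 / (24 * Lf\<^sup>2)) (\<nu> * Theta2 / (2 * Lf\<^sup>2))"
    and rhobar_eq: "rhobar = 1 - min (c2 / 2) (\<delta> / 4 * \<nu>)"
    and q_eq: "q = (1 + p) / (1 - p)"
    and chi1_eq: "chi1 = (1 + p) / 2"
    and chi2_eq: "chi2 = 2 * \<delta>\<^sup>2 * q"
    and chi3_eq: "chi3 = q * 8 * Lf\<^sup>2 * (b\<^sup>2 + 2 * \<delta>\<^sup>2 * Lf\<^sup>2 / (1 - 2 * \<delta> * Lf))"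
    and chi4_eq: "chi4 = (1 + p) / 2 + q * 8 * Lf\<^sup>2 * \<delta>\<^sup>2"
    and chi5_eq: "chi5 = q * (16 * Lf\<^sup>2 * \<delta> * (2 - \<delta> * \<nu>) / (1 - 2 * \<delta> * Lf))"
    and chi6_eq: "chi6 = \<delta> / 2 * Lf\<^sup>2"
    and chi7_eq: "chi7 = 1 - \<delta> / 2 * \<nu>"
    and delta_pos: "0 < \<delta>"
    and delta1: "\<delta> < sqrt (c1 * Theta1) / 2"
    and delta3: "\<delta> < 2 / \<nu>"
    and delta4: "\<delta> < 1 / (8 + 2 * Lf)"
    and delta5: "\<delta> < sqrt c1 / (8 * Lf)"
    and v_pos: "0 < vmin"
    and v_ge: "vmin \<le> v1" "vmin \<le> v2" "vmin \<le> v3"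
    and v_le: "v1 \<le> vmax" "v2 \<le> vmax" "v3 \<le> vmax"
    and row1: "chi1 * v1 + chi2 * v2 = lam * v1"
    and row2: "chi3 * v1 + chi4 * v2 + chi5 * v3 = lam * v2"
    and row3: "chi6 * v1 + chi7 * v3 = lam * v3"
    and z_gt: "rhobar < z" and z_less: "z < 1"
begin

text \<open>0.0857 is \<open>(1 - sqrt 2 / 2)\<^sup>2\<close> rounded down.\<close>

lemma p_bounds: "857 / 10000 < p" "p < 1" "0 < p"
proof -
  have "sqrt 2 < 1.41422" by (rule real_less_lsqrt) (auto simp: power2_eq_square)
  then have "0.29289 < 1 - b" using b_less by simp
  then have "0.29289\<^sup>2 < (1 - b)\<^sup>2" by (intro power_strict_mono) auto
  then show "857 / 10000 < p" using p_ge by (simp add: power2_eq_square)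
  then show "p < 1" "0 < p" using c2_pos c2_less by auto
qed

lemma q_ge: "1 \<le> q" "q * (1 - p) = 1 + p"
  using p_bounds by (auto simp: q_eq field_simps)

lemma c1_pos: "0 < c1"
  using p_bounds c2_less by (simp add: c1_eq)

text \<open>Explains the shape of \<open>c1\<close>: half of this quantity is the distance from
  \<open>chi1\<close> to \<open>1 - c2 / 2\<close>, the room for everything else in the first two
  rows.\<close>

lemma q_c1: "q * c1 = 1 - p - c2"
proof -
  have "1 - p \<noteq> 0" "1 + p \<noteq> 0" using p_bounds by linarith+
  then show ?thesis by (simp add: q_eq c1_eq divide_simps)
qed

lemma Lf2: "0 < Lf\<^sup>2" using Lf_pos by simp

lemma Theta_pos: "0 < Theta2" "0 < Theta1"
proof -
  show 1: "0 < Theta2" using c1_pos Lf2 by (simp add: Theta2_eq)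
  show "0 < Theta1" using c1_pos Lf2 1 nu_pos by (simp add: Theta1_eq)
qed

lemma Theta_Lf: "24 * Lf\<^sup>2 * Theta1 \<le> c1" "32 * Lf\<^sup>2 * Theta2 = c1"
  "2 * Lf\<^sup>2 * Theta1 \<le> \<nu> * Theta2"
proof -
  have "Theta1 \<le> c1 / (24 * Lf\<^sup>2)" "Theta1 \<le> \<nu> * Theta2 / (2 * Lf\<^sup>2)"
    by (auto simp: Theta1_eq)
  then show "24 * Lf\<^sup>2 * Theta1 \<le> c1" "2 * Lf\<^sup>2 * Theta1 \<le> \<nu> * Theta2"
    using Lf2 by (auto simp: pos_le_divide_eq mult.commute)
  show "32 * Lf\<^sup>2 * Theta2 = c1" using Lf2 by (simp add: Theta2_eq)
qed

lemma delta_sq: "4 * \<delta>\<^sup>2 \<le> c1 * Theta1"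
proof -
  have "(2 * \<delta>)\<^sup>2 \<le> (sqrt (c1 * Theta1))\<^sup>2"
    using delta1 delta_pos by (intro power_mono) auto
  then show ?thesis using c1_pos Theta_pos by (simp add: power_mult_distrib)
qed

text \<open>The quadratic bound combines the first step size threshold with
  \<open>Theta1 \<le> c1 / (24 * Lf\<^sup>2)\<close>. It is the sharper one because
  \<open>c1 \<le> 1\<close>, and the estimate of the first iteration relies on it.\<close>

lemma delta_Lf_sq: "64 * (\<delta>\<^sup>2 * Lf\<^sup>2) \<le> c1" "96 * (\<delta>\<^sup>2 * Lf\<^sup>2) \<le> c1\<^sup>2"
proof -
  have "8 * (\<delta> * Lf) \<le> sqrt c1"
    using delta5 Lf_pos by (simp add: pos_less_divide_eq mult_ac)
  then have "(8 * (\<delta> * Lf))\<^sup>2 \<le> (sqrt c1)\<^sup>2"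
    using delta_pos Lf_pos by (intro power_mono) auto
  then show "64 * (\<delta>\<^sup>2 * Lf\<^sup>2) \<le> c1" using c1_pos by (simp add: power_mult_distrib)
  have "96 * (\<delta>\<^sup>2 * Lf\<^sup>2) = (4 * \<delta>\<^sup>2) * (24 * Lf\<^sup>2)" by simp
  also have "\<dots> \<le> (c1 * Theta1) * (24 * Lf\<^sup>2)" using delta_sq Lf2 by (intro mult_right_mono) auto
  also have "\<dots> = c1 * (24 * Lf\<^sup>2 * Theta1)" by simp
  also have "\<dots> \<le> c1 * c1" using Theta_Lf(1) c1_pos by (intro mult_left_mono) auto
  finally show "96 * (\<delta>\<^sup>2 * Lf\<^sup>2) \<le> c1\<^sup>2" by (simp add: power2_eq_square)
qed

lemma delta_linear: "8 * \<delta> + 2 * \<delta> * Lf < 1" "\<delta> < 1 / 8" "\<delta> * \<nu> < 2" "\<delta> * Lf < 1 / 4"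
  "0 < 1 - 2 * \<delta> * Lf"
proof -
  show 1: "8 * \<delta> + 2 * \<delta> * Lf < 1"
    using delta4 Lf_pos by (simp add: pos_less_divide_eq algebra_simps)
  have 2: "0 < \<delta> * Lf" using delta_pos Lf_pos by simp
  show "\<delta> < 1 / 8" "0 < 1 - 2 * \<delta> * Lf" using 1 2 delta_pos by linarith+
  show "\<delta> * \<nu> < 2" using delta3 nu_pos by (simp add: pos_less_divide_eq)
  have "0 < 1 - p" "0 < 1 + p" using p_bounds by auto
  have "(1 - p - c2) * (1 - p) \<le> 1 * (1 - p)"
    using c2_pos p_bounds by (intro mult_right_mono) auto
  also have "\<dots> \<le> 1 + p" using p_bounds by simp
  finally have "c1 \<le> 1" using \<open>0 < 1 + p\<close> by (simp add: c1_eq divide_le_eq)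
  then have "(8 * (\<delta> * Lf))\<^sup>2 \<le> 1\<^sup>2" using delta_Lf_sq(1) by (simp add: power_mult_distrib)
  then have "8 * (\<delta> * Lf) \<le> 1" by (rule power2_le_imp_le) simp
  then show "\<delta> * Lf < 1 / 4" by simp
qed

text \<open>This is what the threshold \<open>1 / (8 + 2 * Lf)\<close> provides.\<close>

lemma delta_ratio: "\<delta> / (1 - 2 * \<delta> * Lf) \<le> 1 / 8"
  using delta_linear(1,5) by (simp add: divide_le_eq)

lemma chi_pos: "0 < chi2" "0 < chi3" "0 < chi5" "0 < chi6" "0 < chi7" "chi1 \<le> chi4" "1 / 2 < chi1"
proof -
  have d: "0 < 1 - 2 * \<delta> * Lf" "0 < 2 - \<delta> * \<nu>" using delta_linear by auto
  have q: "0 < q" using q_ge by simp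
  show "0 < chi2" using q delta_pos by (simp add: chi2_eq)
  show "0 < chi3" using q delta_pos d Lf2 b_pos unfolding chi3_eq
    by (intro mult_pos_pos add_pos_pos divide_pos_pos) auto
  show "0 < chi5" using q delta_pos d Lf2 unfolding chi5_eq
    by (intro mult_pos_pos divide_pos_pos) auto
  show "0 < chi6" using delta_pos Lf2 by (simp add: chi6_eq)
  show "0 < chi7" using d by (simp add: chi7_eq algebra_simps)
  show "chi1 \<le> chi4" using q delta_pos by (simp add: chi1_eq chi4_eq)
  show "1 / 2 < chi1" using p_bounds by (simp add: chi1_eq)
qed

section \<open>Supersolution and eigenvalue\<close>

lemma v_all_pos: "0 < v1" "0 < v2" "0 < v3" "vmin \<le> vmax" "0 < vmax"
  using v_pos v_ge v_le by linarith+

text \<open>Row 1 is the bound \<open>4 * \<delta>\<^sup>2 \<le> c1 * Theta1\<close>. Row 2 spends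
  \<open>c1 / 2\<close> as \<open>c1 / 4 + c1 / 8 + c1 / 8\<close> on \<open>chi3\<close>, on the
  excess of \<open>chi4\<close> over \<open>chi1\<close> and on \<open>chi5\<close>. Row 3 gives up
  half of \<open>\<delta> / 2 * \<nu>\<close>, using the second argument of the minimum in
  \<open>Theta1\<close>.\<close>

lemma test_vector:
  shows "chi1 * Theta1 + chi2 \<le> rhobar * Theta1"
    and "chi3 * Theta1 + chi4 + chi5 * Theta2 \<le> rhobar"
    and "chi6 * Theta1 + chi7 * Theta2 \<le> rhobar * Theta2"
proof -
  have r: "1 - c2 / 2 \<le> rhobar" "1 - \<delta> / 4 * \<nu> \<le> rhobar" by (auto simp: rhobar_eq)
  have q0: "0 < q" using q_ge by simp
  have "chi2 = q * (4 * \<delta>\<^sup>2) / 2" by (simp add: chi2_eq)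
  also have "\<dots> \<le> q * (c1 * Theta1) / 2" using delta_sq q0 by simp
  also have "\<dots> = (1 - p - c2) / 2 * Theta1" using q_c1 by (simp add: mult.assoc[symmetric])
  finally have "chi1 * Theta1 + chi2 \<le> (1 - c2 / 2) * Theta1"
    by (simp add: chi1_eq algebra_simps add_divide_distrib diff_divide_distrib)
  also have "\<dots> \<le> rhobar * Theta1" using r Theta_pos by (intro mult_right_mono) auto
  finally show "chi1 * Theta1 + chi2 \<le> rhobar * Theta1" .
  let ?D = "1 - 2 * \<delta> * Lf"
  have D: "0 < ?D" "1 / 2 < ?D" using delta_linear by auto
  have "(\<delta> * Lf)\<^sup>2 \<le> (1 / 4)\<^sup>2" using delta_linear delta_pos Lf_pos by (intro power_mono) auto
  then have dl: "\<delta>\<^sup>2 * Lf\<^sup>2 \<le> 1 / 16" by (simp add: power_mult_distrib power_divide)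
  have "2 * \<delta>\<^sup>2 * Lf\<^sup>2 / ?D \<le> 1 / 4"
    using D dl by (simp add: divide_le_eq)
  moreover have "b\<^sup>2 \<le> (sqrt 2 / 2)\<^sup>2" using b_less b_pos by (intro power_mono) auto
  ultimately have "b\<^sup>2 + 2 * \<delta>\<^sup>2 * Lf\<^sup>2 / ?D \<le> 3 / 4" by (simp add: power2_eq_square)
  then have "8 * Lf\<^sup>2 * Theta1 * (b\<^sup>2 + 2 * \<delta>\<^sup>2 * Lf\<^sup>2 / ?D) \<le> 8 * Lf\<^sup>2 * Theta1 * (3 / 4)"
    using Lf2 Theta_pos by (intro mult_left_mono) auto
  also have "\<dots> \<le> c1 / 4" using Theta_Lf(1) by (simp add: mult_ac)
  finally have a: "8 * Lf\<^sup>2 * Theta1 * (b\<^sup>2 + 2 * \<delta>\<^sup>2 * Lf\<^sup>2 / ?D) \<le> c1 / 4" .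
  have "16 * Lf\<^sup>2 * \<delta> * (2 - \<delta> * \<nu>) / ?D * Theta2 = 16 * Lf\<^sup>2 * Theta2 * ((2 - \<delta> * \<nu>) * (\<delta> / ?D))"
    by simp
  also have "\<dots> \<le> 16 * Lf\<^sup>2 * Theta2 * (2 * (1 / 8))"
    using delta_ratio delta_linear delta_pos nu_pos Theta_pos
    by (intro mult_left_mono mult_mono) (auto intro!: divide_nonneg_nonneg)
  also have "\<dots> = c1 / 8" using Theta_Lf(2) by (simp add: mult_ac)
  finally have c: "16 * Lf\<^sup>2 * \<delta> * (2 - \<delta> * \<nu>) / ?D * Theta2 \<le> c1 / 8" .
  have "(1 - p - c2) / 2 = 1 - c2 / 2 - chi1" by (simp add: chi1_eq field_simps)
  have "chi3 * Theta1 + (chi4 - chi1) + chi5 * Theta2 =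
     q * (8 * Lf\<^sup>2 * Theta1 * (b\<^sup>2 + 2 * \<delta>\<^sup>2 * Lf\<^sup>2 / ?D) + 8 * (\<delta>\<^sup>2 * Lf\<^sup>2)
       + 16 * Lf\<^sup>2 * \<delta> * (2 - \<delta> * \<nu>) / ?D * Theta2)"
    unfolding chi3_eq chi4_eq chi5_eq chi1_eq by (simp add: algebra_simps)
  also have "\<dots> \<le> q * (c1 / 4 + c1 / 8 + c1 / 8)"
    using a c delta_Lf_sq(1) q0 by (intro mult_left_mono add_mono) auto
  also have "\<dots> = (1 - p - c2) / 2" using q_c1 by simp
  finally show "chi3 * Theta1 + chi4 + chi5 * Theta2 \<le> rhobar"
    using r(1) \<open>(1 - p - c2) / 2 = 1 - c2 / 2 - chi1\<close> by linarith
  have "chi6 * Theta1 = \<delta> / 4 * (2 * Lf\<^sup>2 * Theta1)" by (simp add: chi6_eq)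
  also have "\<dots> \<le> \<delta> / 4 * (\<nu> * Theta2)"
    using Theta_Lf(3) delta_pos by (intro mult_left_mono) auto
  finally have "chi6 * Theta1 + chi7 * Theta2 \<le> (1 - \<delta> / 4 * \<nu>) * Theta2"
    by (simp add: chi7_eq algebra_simps)
  also have "\<dots> \<le> rhobar * Theta2" using r(2) Theta_pos by (intro mult_right_mono) auto
  finally show "chi6 * Theta1 + chi7 * Theta2 \<le> rhobar * Theta2" .
qed

text \<open>Collatz-Wielandt argument: scale the supersolution by the least \<open>t\<close> for
  which it dominates the eigenvector, and compare the two in a row where they touch. The lower
  bounds come from the positive off-diagonal terms.\<close>

lemma lam_bounds: "lam \<le> rhobar" "chi1 < lam" "chi4 < lam" "lam < z"
proof -
  note v = v_all_pos
  define t where "t = Max {v1 / Theta1, v2, v3 / Theta2}"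
  have tt: "v1 / Theta1 \<le> t" "v2 \<le> t" "v3 / Theta2 \<le> t"
    unfolding t_def by (intro Max_ge; simp)+
  have t: "v1 \<le> t * Theta1" "v2 \<le> t" "v3 \<le> t * Theta2"
    using tt Theta_pos by (auto simp: pos_divide_le_eq)
  have t0: "0 < t" using t(2) v by simp
  have "t \<in> {v1 / Theta1, v2, v3 / Theta2}" unfolding t_def by (rule Max_in) auto
  then consider "v1 = t * Theta1" | "v2 = t" | "v3 = t * Theta2" using Theta_pos by auto
  then show "lam \<le> rhobar"
  proof cases
    case 1
    have "lam * v1 = chi1 * v1 + chi2 * v2" using row1 by simp
    also have "\<dots> \<le> chi1 * (t * Theta1) + chi2 * t"
      using t chi_pos by (intro add_mono mult_left_mono) auto
    also have "\<dots> = t * (chi1 * Theta1 + chi2)" by (simp add: algebra_simps)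
    also have "\<dots> \<le> t * (rhobar * Theta1)" using test_vector t0 by (intro mult_left_mono) auto
    also have "\<dots> = rhobar * v1" by (simp add: 1)
    finally show ?thesis using v by simp
  next
    case 2
    have "lam * v2 = chi3 * v1 + chi4 * v2 + chi5 * v3" using row2 by simp
    also have "\<dots> \<le> chi3 * (t * Theta1) + chi4 * t + chi5 * (t * Theta2)"
      using t chi_pos by (intro add_mono mult_left_mono) auto
    also have "\<dots> = t * (chi3 * Theta1 + chi4 + chi5 * Theta2)" by (simp add: algebra_simps)
    also have "\<dots> \<le> t * rhobar" using test_vector t0 by (intro mult_left_mono) auto
    also have "\<dots> = rhobar * v2" by (simp add: 2)
    finally show ?thesis using v by simp
  next
    case 3
    have "lam * v3 = chi6 * v1 + chi7 * v3" using row3 by simp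
    also have "\<dots> \<le> chi6 * (t * Theta1) + chi7 * (t * Theta2)"
      using t chi_pos by (intro add_mono mult_left_mono) auto
    also have "\<dots> = t * (chi6 * Theta1 + chi7 * Theta2)" by (simp add: algebra_simps)
    also have "\<dots> \<le> t * (rhobar * Theta2)" using test_vector t0 by (intro mult_left_mono) auto
    also have "\<dots> = rhobar * v3" by (simp add: 3)
    finally show ?thesis using v by simp
  qed
  then show "lam < z" using z_gt by simp
  have "0 < chi2 * v2" using chi_pos v by simp
  then have "chi1 * v1 < lam * v1" using row1 by linarith
  then show "chi1 < lam" using v by simp
  have "0 < chi3 * v1" "0 < chi5 * v3" using chi_pos v by auto
  then have "chi4 * v2 < lam * v2" using row2 by linarith
  then show "chi4 < lam" using v by simp
qed

lemma z_half: "1 / 2 < z"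
  using lam_bounds(2,4) chi_pos(7) by linarith

text \<open>A small \<open>z\<close> forces \<open>c2\<close> and \<open>\<delta> * \<nu>\<close> to
  be large; the numerical case distinctions live on this.\<close>

lemma c2_gt: "2 * (1 - z) < c2" "4 * (1 - z) < \<delta> * \<nu>"
  using z_gt by (auto simp: rhobar_eq min_def split: if_splits)

text \<open>Both follow from \<open>descent\<close> with the new gap discarded. The first produces
  the second summand of \<open>chi3\<close> and all of \<open>chi5\<close>; \<open>U_step\<close>
  needs only 8 instead of 16, but the first iteration uses the full coefficient. The second leads to
  \<open>sigma7\<close>.\<close>

lemma mean_gradient_bounds:
  assumes "0 \<le> X" "0 \<le> G" "0 \<le> N"
    and le: "\<delta> / 2 * (1 - \<delta> * Lf) * N \<le> (1 - \<delta> * \<nu>) * G + \<delta> / 2 * Lf\<^sup>2 * X"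
  shows "q * (16 * Lf\<^sup>2 * \<delta>\<^sup>2 * N) \<le>
      q * 8 * Lf\<^sup>2 * (2 * \<delta>\<^sup>2 * Lf\<^sup>2 / (1 - 2 * \<delta> * Lf)) * X + chi5 * G"
    and "\<delta> / 2 * (1 - 2 * \<delta> * Lf) * N \<le> chi7 * G + chi6 * X"
proof -
  let ?D = "1 - 2 * \<delta> * Lf"
  have D: "0 < ?D" using delta_linear by simp
  have q0: "0 < q" using q_ge by simp
  have "\<delta> / 2 * ?D * N \<le> \<delta> / 2 * (1 - \<delta> * Lf) * N"
    using delta_pos Lf_pos assms(3) by (intro mult_right_mono mult_left_mono) auto
  then have n: "\<delta> / 2 * ?D * N \<le> (1 - \<delta> * \<nu>) * G + \<delta> / 2 * Lf\<^sup>2 * X"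
    using le by linarith
  have g: "0 \<le> \<delta> * \<nu> * G" using delta_pos nu_pos assms(2) by simp
  have "(1 - \<delta> * \<nu>) * G \<le> chi7 * G" using g by (simp add: chi7_eq algebra_simps)
  then show "\<delta> / 2 * ?D * N \<le> chi7 * G + chi6 * X"
    using n unfolding chi6_eq by linarith
  have "2 * ((1 - \<delta> * \<nu>) * G) \<le> (2 - \<delta> * \<nu>) * G" using g by (simp add: algebra_simps)
  then have "2 * (\<delta> / 2 * ?D * N) \<le> (2 - \<delta> * \<nu>) * G + 2 * (\<delta> / 2 * Lf\<^sup>2 * X)"
    using n by linarith
  moreover have "2 * (\<delta> / 2 * ?D * N) = N * (\<delta> * ?D)" "2 * (\<delta> / 2 * Lf\<^sup>2 * X) = \<delta> * Lf\<^sup>2 * X"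
    by simp_all
  ultimately have "N * (\<delta> * ?D) \<le> (2 - \<delta> * \<nu>) * G + \<delta> * Lf\<^sup>2 * X" by linarith
  then have "N \<le> ((2 - \<delta> * \<nu>) * G + \<delta> * Lf\<^sup>2 * X) / (\<delta> * ?D)"
    using D delta_pos pos_le_divide_eq[of "\<delta> * ?D"] by simp
  then have "q * (16 * Lf\<^sup>2 * \<delta>\<^sup>2 * N) \<le> q * (16 * Lf\<^sup>2 * \<delta>\<^sup>2 * (((2 - \<delta> * \<nu>) * G + \<delta> * Lf\<^sup>2 * X) / (\<delta> * ?D)))"
    using q0 by (intro mult_left_mono) auto
  also have "\<dots> = q * 8 * Lf\<^sup>2 * (2 * \<delta>\<^sup>2 * Lf\<^sup>2 / ?D) * X + chi5 * G"
    unfolding chi5_eq using D delta_pos by (simp add: divide_simps power2_eq_square) (simp add: algebra_simps)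
  finally show "q * (16 * Lf\<^sup>2 * \<delta>\<^sup>2 * N) \<le> q * 8 * Lf\<^sup>2 * (2 * \<delta>\<^sup>2 * Lf\<^sup>2 / ?D) * X + chi5 * G" .
qed

section \<open>Numerical margins\<close>

lemma q_gt: "1187 / 1000 \<le> q"
  using p_bounds by (simp add: q_eq pos_le_divide_eq)

lemma c1_le:
  assumes "e \<le> c2" shows "c1 \<le> (9143 / 10000 - e) / (1187 / 1000)"
proof -
  have "1187 / 1000 * c1 \<le> q * c1" using q_gt c1_pos by (intro mult_right_mono) auto
  also have "\<dots> \<le> 9143 / 10000 - e" using q_c1 p_bounds assms by simp
  finally show ?thesis by (simp add: pos_le_divide_eq mult.commute)
qed

text \<open>0.54285 is the lower bound on \<open>chi1\<close> that follows from
  \<open>p_bounds\<close>. The multiple of \<open>q\<close> on the right will cancel against the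
  \<open>q\<close> in \<open>N_bound\<close>.\<close>

lemma chi_gap: "lam - chi4 \<le> (z - 54285 / 100000) * (q / (1187 / 1000))"
proof -
  have "lam - chi4 \<le> z - 54285 / 100000"
    using lam_bounds(4) chi_pos(6) p_bounds by (simp add: chi1_eq)
  also have "\<dots> \<le> (z - 54285 / 100000) * (q / (1187 / 1000))"
  proof -
    have "0 \<le> z - 54285 / 100000"
      using lam_bounds(2,4) p_bounds by (simp add: chi1_eq)
    moreover have "1 \<le> q / (1187 / 1000)" using q_gt by simp
    ultimately show ?thesis using mult_left_mono[of 1 "q / (1187 / 1000)"] by fastforce
  qed
  finally show ?thesis .
qed

text \<open>If all entries of the eigenvector were within a factor 2, the three eigenvalue equations
  would force \<open>\<delta> / 4 * \<nu>\<close> below \<open>1 / 4\<close>.\<close>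

lemma ratio_ge:
  assumes z: "z < 3 / 4"
  shows "2 * vmin \<le> vmax"
proof (rule ccontr)
  assume "\<not> 2 * vmin \<le> vmax"
  then have r: "vmax < 2 * vmin" by simp
  have v12: "v2 \<le> 2 * v1" "v1 \<le> 2 * v2" "v1 \<le> 2 * v3" using r v_ge v_le by linarith+
  note v = v_all_pos
  have q0: "0 < q" using q_ge by simp
  \<comment> \<open>Row 1 bounds \<open>lam - chi1\<close> by a multiple of
    \<open>\<delta>\<^sup>2\<close>, and row 2 passes this on to \<open>chi3\<close>, so that
    \<open>Lf * b\<close> is at most \<open>\<delta>\<close>.\<close>
  have "(lam - chi1) * v1 = chi2 * v2" using row1 by (simp add: algebra_simps)
  also have "\<dots> \<le> chi2 * (2 * v1)" using v12 chi_pos by (intro mult_left_mono) auto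
  finally have a: "lam - chi1 \<le> 2 * chi2" using v by (simp add: mult.left_commute[of chi2])
  have "chi3 * v1 \<le> (lam - chi4) * v2"
    using row2 mult_pos_pos[OF chi_pos(3) v(3)] unfolding left_diff_distrib by linarith
  also have "\<dots> \<le> (lam - chi4) * (2 * v1)"
    using v12 lam_bounds by (intro mult_left_mono) auto
  also have "\<dots> \<le> (2 * chi2) * (2 * v1)"
    using a chi_pos v by (intro mult_right_mono) auto
  finally have "chi3 \<le> 4 * chi2" using v by simp
  moreover have "q * 8 * Lf\<^sup>2 * b\<^sup>2 \<le> chi3"
    unfolding chi3_eq using q0 delta_linear by (intro mult_left_mono) auto
  ultimately have "q * (8 * (Lf\<^sup>2 * b\<^sup>2)) \<le> q * (8 * \<delta>\<^sup>2)" by (simp add: chi2_eq mult_ac)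
  then have lb: "Lf\<^sup>2 * b\<^sup>2 \<le> \<delta>\<^sup>2" using q0 by simp
  \<comment> \<open>In row 3, \<open>chi7\<close> is below 0.5 and \<open>lam\<close> above 0.54, so
    \<open>chi6\<close> must fill the gap; hence \<open>\<delta> * Lf\<^sup>2\<close> cannot be
    small.\<close>
  have "(lam - chi7) * v3 = chi6 * v1" using row3 by (simp add: algebra_simps)
  also have "\<dots> \<le> chi6 * (2 * v3)" using v12 chi_pos by (intro mult_left_mono) auto
  finally have "lam - chi7 \<le> 2 * chi6" using v by (simp add: mult.left_commute[of chi6])
  moreover have "chi7 < 1 / 2" using c2_gt z by (simp add: chi7_eq)
  ultimately have d: "0.04 \<le> \<delta> * Lf\<^sup>2"
    using lam_bounds(2) p_bounds by (simp add: chi6_eq chi1_eq)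
  have "(1 - b)\<^sup>2 < 1 / 2" using p_ge c2_less c2_gt z by simp
  also have "1 / 2 < (0.71 :: real)\<^sup>2" by (simp add: power2_eq_square)
  finally have "1 - b < 0.71" using power2_less_imp_less by fastforce
  then have "0.29\<^sup>2 \<le> b\<^sup>2" by (intro power_mono) auto
  then have "0.08 \<le> b\<^sup>2" by (simp add: power2_eq_square)
  \<comment> \<open>The contradiction: 0.0032 would be at most \<open>\<delta> ^ 3\<close>, hence at
    most 1 / 512.\<close>
  then have "0.04 * 0.08 \<le> (\<delta> * Lf\<^sup>2) * b\<^sup>2" using d by (intro mult_mono) auto
  also have "\<dots> = \<delta> * (Lf\<^sup>2 * b\<^sup>2)" by simp
  also have "\<dots> \<le> \<delta> * \<delta>\<^sup>2" using lb delta_pos by (intro mult_left_mono) auto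
  also have "\<dots> = \<delta> ^ 3" by (simp add: power3_eq_cube power2_eq_square)
  also have "\<dots> \<le> (1 / 8) ^ 3" using delta_linear delta_pos by (intro power_mono) auto
  finally show False by (simp add: power3_eq_cube)
qed

end

text \<open>\<open>unsat k\<close> will mean that the estimates at time \<open>k\<close> have the
  precision of unsaturated quantizers. It starts at time 1, as the estimation error at time 0 is the
  initial value itself. \<open>unsat_step\<close> is where the size of \<open>K\<close>
  enters.\<close>

locale tracking_errors = tracking_gains +
  fixes X U G N Ex Eu :: "nat \<Rightarrow> real" and B :: real and unsat :: "nat \<Rightarrow> bool"
  assumes nonneg: "0 \<le> X k" "0 \<le> U k" "0 \<le> G k" "0 \<le> N k" "0 \<le> Ex k" "0 \<le> Eu k"
    and B_nonneg: "0 \<le> B"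
    and descent: "G (Suc k) + \<delta> / 2 * (1 - \<delta> * Lf) * N k \<le> (1 - \<delta> * \<nu>) * G k + \<delta> / 2 * Lf\<^sup>2 * X k"
    and G_zero: "1 < \<delta> * \<nu> \<Longrightarrow> G k = 0"
    and start: "X 0 \<le> B" "U 0 \<le> B" "G 0 \<le> B"
    and X_start: "0 < t \<Longrightarrow> X 1 \<le> (1 + t) * X 0 + (1 + 1 / t) * (\<delta>\<^sup>2 * U 0)"
    and U_start: "0 < t \<Longrightarrow> U 1 \<le> (1 + t) * U 0 + (1 + 1 / t) * (\<delta>\<^sup>2 * Lf\<^sup>2 * (U 0 + N 0))"
    and X_step: "0 < t \<Longrightarrow> X (Suc k) \<le> (1 + t) * p * X k + (1 + 1 / t) * (2 * b\<^sup>2 * Ex k + 2 * \<delta>\<^sup>2 * U k)"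
    and U_step: "0 < t \<Longrightarrow> U (Suc k) \<le> (1 + t) * p * U k
      + (1 + 1 / t) * (2 * b\<^sup>2 * Eu k + 8 * Lf\<^sup>2 * (b\<^sup>2 * X k + b\<^sup>2 * Ex k + \<delta>\<^sup>2 * U k + \<delta>\<^sup>2 * N k))"
    and noise: "1 \<le> k \<Longrightarrow> unsat k \<Longrightarrow> q * (2 * b\<^sup>2 * Ex k) \<le> B * z ^ k * (z - rhobar)"
      "1 \<le> k \<Longrightarrow> unsat k \<Longrightarrow> q * (2 * b\<^sup>2 * (Eu k + 4 * Lf\<^sup>2 * Ex k)) \<le> B * z ^ k * (z - rhobar)"
    and unsat_start: "unsat 1"
    and unsat_step: "1 \<le> k \<Longrightarrow> unsat k \<Longrightarrow> X k \<le> sqrt 3 * (vmax / vmin) * B * z ^ k \<Longrightarrow>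
      U k \<le> sqrt 3 * (vmax / vmin) * B * z ^ k \<Longrightarrow> G k \<le> sqrt 3 * (vmax / vmin) * B * z ^ k \<Longrightarrow>
      unsat (Suc k)"
begin

definition dominated :: "nat \<Rightarrow> real \<Rightarrow> bool" where
  "dominated k a \<longleftrightarrow> X k \<le> a * v1 \<and> U k \<le> a * v2 \<and> G k \<le> a * v3"

lemma N_bound:
  "q * (16 * Lf\<^sup>2 * \<delta>\<^sup>2 * N k) \<le>
    q * 8 * Lf\<^sup>2 * (2 * \<delta>\<^sup>2 * Lf\<^sup>2 / (1 - 2 * \<delta> * Lf)) * X k + chi5 * G k"
proof (rule mean_gradient_bounds(1))
  show "\<delta> / 2 * (1 - \<delta> * Lf) * N k \<le> (1 - \<delta> * \<nu>) * G k + \<delta> / 2 * Lf\<^sup>2 * X k"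
    using descent[of k] nonneg(3)[of "Suc k"] by linarith
qed (rule nonneg)+

lemma G_step:
  assumes "0 \<le> a" "X k \<le> a * v1" "G k \<le> a * v3"
  shows "G (Suc k) \<le> a * lam * v3"
proof -
  have "0 \<le> \<delta> / 2 * (1 - \<delta> * Lf) * N k" "0 \<le> \<delta> * \<nu> * G k"
    using delta_pos delta_linear(4) nonneg nu_pos by auto
  moreover from this(2) have "(1 - \<delta> * \<nu>) * G k \<le> chi7 * G k"
    by (simp add: chi7_eq algebra_simps)
  ultimately have "G (Suc k) \<le> chi7 * G k + chi6 * X k"
    using descent[of k] unfolding chi6_eq by linarith
  also have "\<dots> \<le> chi7 * (a * v3) + chi6 * (a * v1)"
    using assms chi_pos by (intro add_mono mult_left_mono) auto
  also have "\<dots> = a * (chi6 * v1 + chi7 * v3)" by (simp add: algebra_simps)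
  finally show ?thesis using row3 by simp
qed

text \<open>\<open>z - rhobar\<close> pays for the noise and \<open>lam - chi1\<close> for the
  coupling, which the eigenvalue equation evaluates; \<open>lam \<le> rhobar\<close> makes the sum
  at most \<open>z - chi1\<close>. The diagonal part is left out so that another Young parameter can
  be used with the same bound.\<close>

lemma perturbation:
  assumes "1 \<le> k" "unsat k" "dominated k a" "B * z ^ k \<le> a * vmin"
  shows "q * (2 * b\<^sup>2 * Ex k + 2 * \<delta>\<^sup>2 * U k) \<le> a * v1 * (z - chi1)"
    and "q * (2 * b\<^sup>2 * Eu k + 8 * Lf\<^sup>2 * (b\<^sup>2 * X k + b\<^sup>2 * Ex k + \<delta>\<^sup>2 * U k + \<delta>\<^sup>2 * N k))
      \<le> a * v2 * (z - chi1)"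
proof -
  note v = v_all_pos
  have Bz: "0 \<le> B * z ^ k" using B_nonneg z_half by simp
  then have "0 \<le> a * vmin" using assms(4) by simp
  then have a0: "0 \<le> a" using v_pos by (simp add: zero_le_mult_iff)
  have d: "X k \<le> a * v1" "U k \<le> a * v2" "G k \<le> a * v3"
    using assms(3) by (auto simp: dominated_def)
  have nz: "B * z ^ k * (z - rhobar) \<le> a * w * (z - rhobar)" if "vmin \<le> w" for w
  proof -
    have "a * vmin \<le> a * w" using a0 that by (rule mult_left_mono[rotated])
    then show ?thesis using assms(4) z_gt by (intro mult_right_mono) auto
  qed
  have lr: "a * w * (z - rhobar) + a * w * (lam - chi1) \<le> a * w * (z - chi1)" if "0 < w" for w
  proof -
    have "a * w * (z - rhobar + (lam - chi1)) \<le> a * w * (z - chi1)"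
      using a0 that lam_bounds(1) by (intro mult_left_mono) auto
    then show ?thesis by (simp add: distrib_left)
  qed
  have "q * (2 * b\<^sup>2 * Ex k + 2 * \<delta>\<^sup>2 * U k) = q * (2 * b\<^sup>2 * Ex k) + chi2 * U k"
    by (simp add: chi2_eq algebra_simps)
  also have "\<dots> \<le> a * v1 * (z - rhobar) + chi2 * (a * v2)"
    using noise(1)[OF assms(1,2)] nz[OF v_ge(1)] d chi_pos by (intro add_mono mult_left_mono) auto
  also have "chi2 * (a * v2) = a * (chi2 * v2)" by simp
  also have "\<dots> = a * v1 * (lam - chi1)"
    using row1 by (simp add: algebra_simps) (metis distrib_left)
  also have "a * v1 * (z - rhobar) + a * v1 * (lam - chi1) \<le> a * v1 * (z - chi1)"
    using lr v by simp
  finally show "q * (2 * b\<^sup>2 * Ex k + 2 * \<delta>\<^sup>2 * U k) \<le> a * v1 * (z - chi1)" .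
  let ?D = "1 - 2 * \<delta> * Lf"
  have q0: "0 < q" using q_ge by simp
  have N: "q * (8 * Lf\<^sup>2 * \<delta>\<^sup>2 * N k) \<le>
      q * 8 * Lf\<^sup>2 * (2 * \<delta>\<^sup>2 * Lf\<^sup>2 / ?D) * X k + chi5 * G k"
  proof -
    have "q * (8 * Lf\<^sup>2 * \<delta>\<^sup>2 * N k) \<le> q * (16 * Lf\<^sup>2 * \<delta>\<^sup>2 * N k)"
      using q0 nonneg by (intro mult_left_mono mult_right_mono) auto
    then show ?thesis using N_bound[of k] by linarith
  qed
  have "q * (2 * b\<^sup>2 * Eu k + 8 * Lf\<^sup>2 * (b\<^sup>2 * X k + b\<^sup>2 * Ex k + \<delta>\<^sup>2 * U k + \<delta>\<^sup>2 * N k))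
    = q * (2 * b\<^sup>2 * (Eu k + 4 * Lf\<^sup>2 * Ex k)) + q * 8 * Lf\<^sup>2 * b\<^sup>2 * X k
      + (chi4 - chi1) * U k + q * (8 * Lf\<^sup>2 * \<delta>\<^sup>2 * N k)"
    by (simp add: chi4_eq chi1_eq algebra_simps)
  also have "\<dots> \<le> a * v2 * (z - rhobar) + q * 8 * Lf\<^sup>2 * b\<^sup>2 * X k
      + (chi4 - chi1) * U k + (q * 8 * Lf\<^sup>2 * (2 * \<delta>\<^sup>2 * Lf\<^sup>2 / ?D) * X k + chi5 * G k)"
    using noise(2)[OF assms(1,2)] nz[OF v_ge(2)] N by linarith
  also have "\<dots> = a * v2 * (z - rhobar) + (chi3 * X k + (chi4 - chi1) * U k + chi5 * G k)"
    unfolding chi3_eq by (simp add: algebra_simps)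
  also have "\<dots> \<le> a * v2 * (z - rhobar) + (chi3 * (a * v1) + (chi4 - chi1) * (a * v2) + chi5 * (a * v3))"
    using d chi_pos by (intro add_mono mult_left_mono order_refl) auto
  also have "chi3 * (a * v1) + (chi4 - chi1) * (a * v2) + chi5 * (a * v3)
      = a * (chi3 * v1 + chi4 * v2 + chi5 * v3) - a * (chi1 * v2)"
    by (simp add: algebra_simps)
  also have "\<dots> = a * v2 * (lam - chi1)" unfolding row2 by (simp add: algebra_simps)
  also have "a * v2 * (z - rhobar) + a * v2 * (lam - chi1) \<le> a * v2 * (z - chi1)"
    using lr v by simp
  finally show "q * (2 * b\<^sup>2 * Eu k + 8 * Lf\<^sup>2 * (b\<^sup>2 * X k + b\<^sup>2 * Ex k + \<delta>\<^sup>2 * U k + \<delta>\<^sup>2 * N k))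
      \<le> a * v2 * (z - chi1)" .
qed

lemma dominated_step:
  assumes "1 \<le> k" "unsat k" "dominated k a" "B * z ^ k \<le> a * vmin"
  shows "dominated (Suc k) (a * z)"
proof -
  \<comment> \<open>This is \<open>sigma1\<close>.\<close>
  define t where "t = (1 - p) / (2 * p)"
  have t0: "0 < t" using p_bounds by (simp add: t_def)
  have t1: "(1 + t) * p = chi1" using p_bounds by (simp add: t_def chi1_eq field_simps)
  have t2: "1 + 1 / t = q"
  proof -
    have "1 - p \<noteq> 0" "p \<noteq> 0" using p_bounds by linarith+
    then show ?thesis by (simp add: t_def q_eq divide_simps)
  qed
  have "0 \<le> B * z ^ k" using B_nonneg z_half by simp
  then have "0 \<le> a * vmin" using assms(4) by simp
  then have a0: "0 \<le> a" using v_pos by (simp add: zero_le_mult_iff)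
  have d: "X k \<le> a * v1" "U k \<le> a * v2" "G k \<le> a * v3"
    using assms(3) by (auto simp: dominated_def)
  have c0: "0 \<le> chi1" using chi_pos by simp
  have "X (Suc k) \<le> chi1 * X k + q * (2 * b\<^sup>2 * Ex k + 2 * \<delta>\<^sup>2 * U k)"
    using X_step[OF t0, of k] by (simp add: t1 t2)
  also have "\<dots> \<le> chi1 * (a * v1) + a * v1 * (z - chi1)"
    using d c0 perturbation(1)[OF assms] by (intro add_mono mult_left_mono) auto
  finally have x: "X (Suc k) \<le> a * z * v1" by (simp add: algebra_simps)
  have "U (Suc k) \<le> chi1 * U k + q * (2 * b\<^sup>2 * Eu k + 8 * Lf\<^sup>2 * (b\<^sup>2 * X k + b\<^sup>2 * Ex k + \<delta>\<^sup>2 * U k + \<delta>\<^sup>2 * N k))"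
    using U_step[OF t0, of k] by (simp add: t1 t2)
  also have "\<dots> \<le> chi1 * (a * v2) + a * v2 * (z - chi1)"
    using d c0 perturbation(2)[OF assms] by (intro add_mono mult_left_mono) auto
  finally have u: "U (Suc k) \<le> a * z * v2" by (simp add: algebra_simps)
  have "G (Suc k) \<le> a * lam * v3" using G_step a0 d by simp
  also have "\<dots> \<le> a * z * v3"
    using a0 lam_bounds(4) v_all_pos by (intro mult_right_mono mult_left_mono) auto
  finally show ?thesis using x u by (simp add: dominated_def)
qed

section \<open>Propagation of the geometric bound\<close>

abbreviation level :: "nat \<Rightarrow> real" where
  "level k \<equiv> sqrt 3 * (B / vmin) * z ^ k"

lemma sqrt3_ge: "1732 / 1000 \<le> sqrt 3"
  by (rule real_le_rsqrt) (simp add: power2_eq_square)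

lemma level_nonneg: "0 \<le> level k"
  using B_nonneg v_pos z_half by simp

lemma dominated_level_bounds:
  assumes "dominated k (level k)"
  shows "X k \<le> sqrt 3 * (vmax / vmin) * B * z ^ k" "U k \<le> sqrt 3 * (vmax / vmin) * B * z ^ k"
    "G k \<le> sqrt 3 * (vmax / vmin) * B * z ^ k"
proof -
  have "level k * w \<le> sqrt 3 * (vmax / vmin) * B * z ^ k" if "w \<le> vmax" for w
    using mult_left_mono[OF that level_nonneg[of k]] by (simp add: mult_ac)
  then show "X k \<le> sqrt 3 * (vmax / vmin) * B * z ^ k" "U k \<le> sqrt 3 * (vmax / vmin) * B * z ^ k"
    "G k \<le> sqrt 3 * (vmax / vmin) * B * z ^ k"
    using assms v_le unfolding dominated_def by (meson order_trans)+
qed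

text \<open>The starting time is 1 or 2, depending on when the level is reached.\<close>

lemma dominated_level:
  assumes "1 \<le> k0" "unsat k0" "dominated k0 (level k0)" "k0 \<le> k"
  shows "unsat k \<and> dominated k (level k)"
  using assms(4)
proof (induction k rule: dec_induct)
  case base
  then show ?case using assms by simp
next
  case (step n)
  have n: "1 \<le> n" using assms(1) step by simp
  have "B * z ^ n \<le> level n * vmin"
  proof -
    have "1 * (B * z ^ n) \<le> sqrt 3 * (B * z ^ n)"
      using B_nonneg z_half by (intro mult_right_mono) auto
    then show ?thesis using v_pos by simp
  qed
  with n step have "dominated (Suc n) (level n * z)" by (intro dominated_step) auto
  moreover have "unsat (Suc n)"
    using n step dominated_level_bounds by (intro unsat_step) auto
  ultimately show ?case by (simp add: mult_ac)
qed

text \<open>\<open>N_bound\<close> trades the mean part \<open>N 0\<close> for \<open>X 0\<close>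
  and \<open>G 0\<close>, which row 2 sums to a multiple of \<open>lam - chi4\<close>. The share of
  \<open>U 0\<close> remains a multiple of \<open>B\<close> instead of the larger
  \<open>B / vmin * v2\<close>; this pays off when the eigenvector is spread.\<close>

lemma U_start_bound:
  assumes "0 < t" "\<delta>\<^sup>2 * Lf\<^sup>2 \<le> g" "lam - chi4 \<le> e * q"
  shows "U 1 \<le> (1 + t + (1 + 1 / t) * g) * B + (1 + 1 / t) * (e / 16) * (B / vmin * v2)"
proof -
  note v = v_all_pos
  have q0: "0 < q" using q_ge by simp
  have Bv: "B \<le> B / vmin * w" if "vmin \<le> w" for w
    using mult_left_mono[OF that B_nonneg] v_pos by (simp add: pos_le_divide_eq)
  have x0: "X 0 \<le> B / vmin * v1" "G 0 \<le> B / vmin * v3"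
    using start Bv[OF v_ge(1)] Bv[OF v_ge(3)] by linarith+
  have "q * 8 * Lf\<^sup>2 * (2 * \<delta>\<^sup>2 * Lf\<^sup>2 / (1 - 2 * \<delta> * Lf)) * X 0 \<le> chi3 * X 0"
    unfolding chi3_eq using q0 nonneg by (intro mult_right_mono mult_left_mono) auto
  then have "q * (16 * Lf\<^sup>2 * \<delta>\<^sup>2 * N 0) \<le> chi3 * X 0 + chi5 * G 0" using N_bound[of 0] by linarith
  also have "\<dots> \<le> chi3 * (B / vmin * v1) + chi5 * (B / vmin * v3)"
    using x0 chi_pos by (intro add_mono mult_left_mono) auto
  also have "\<dots> = B / vmin * (chi3 * v1 + chi4 * v2 + chi5 * v3) - B / vmin * (chi4 * v2)"
    by (simp add: algebra_simps add_divide_distrib)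
  also have "\<dots> = (lam - chi4) * (B / vmin * v2)" unfolding row2 by (simp add: algebra_simps diff_divide_distrib)
  also have "\<dots> \<le> (e * q) * (B / vmin * v2)"
    using assms(3) B_nonneg v v_pos by (intro mult_right_mono) auto
  finally have "q * (\<delta>\<^sup>2 * Lf\<^sup>2 * N 0) \<le> q * (e / 16 * (B / vmin * v2))" by (simp add: mult_ac)
  then have n: "\<delta>\<^sup>2 * Lf\<^sup>2 * N 0 \<le> e / 16 * (B / vmin * v2)" using q0 by (rule mult_left_le_imp_le)
  have "\<delta>\<^sup>2 * Lf\<^sup>2 * U 0 \<le> g * B"
    using assms(2) start nonneg order_trans[OF _ assms(2), of 0] by (intro mult_mono) auto
  then have "\<delta>\<^sup>2 * Lf\<^sup>2 * (U 0 + N 0) \<le> g * B + e / 16 * (B / vmin * v2)"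
    using n by (simp add: distrib_left)
  then have "(1 + 1 / t) * (\<delta>\<^sup>2 * Lf\<^sup>2 * (U 0 + N 0)) \<le> (1 + 1 / t) * (g * B + e / 16 * (B / vmin * v2))"
    using assms(1) by (intro mult_left_mono) auto
  moreover have "(1 + t) * U 0 \<le> (1 + t) * B" using start assms(1) by (intro mult_left_mono) auto
  ultimately have "U 1 \<le> (1 + t) * B + (1 + 1 / t) * (g * B + e / 16 * (B / vmin * v2))"
    using U_start[OF assms(1)] by linarith
  then show ?thesis by (simp add: algebra_simps)
qed

section \<open>The first two iterations\<close>

lemma scaled_B: "B \<le> B / vmin * v1" "B \<le> B / vmin * v2" "B \<le> B / vmin * v3"
  using mult_left_mono[OF v_ge(1) B_nonneg] mult_left_mono[OF v_ge(2) B_nonneg]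
    mult_left_mono[OF v_ge(3) B_nonneg] v_pos by (auto simp: pos_le_divide_eq)

lemma X_start_bound: "X 1 \<le> 81 / 64 * B"
proof -
  have "\<delta>\<^sup>2 \<le> (1 / 8)\<^sup>2" using delta_linear delta_pos by (intro power_mono) auto
  then have "\<delta>\<^sup>2 * U 0 \<le> (1 / 8)\<^sup>2 * B" using start nonneg by (intro mult_mono) auto
  \<comment> \<open>Young's parameter equals the bound on \<open>\<delta>\<close>, the best choice:
    the constant is \<open>(1 + 1 / 8)\<^sup>2\<close>.\<close>
  then show ?thesis using X_start[of "1 / 8"] start by (simp add: power2_eq_square)
qed

lemma G_start_bound: "G 1 \<le> z * (B / vmin * v3)"
proof -
  have bv: "0 \<le> B / vmin" using B_nonneg v_pos by simp
  have "G (Suc 0) \<le> B / vmin * lam * v3" using start scaled_B bv by (intro G_step) linarith+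
  also have "\<dots> \<le> B / vmin * z * v3"
    using bv lam_bounds(4) v_all_pos by (intro mult_right_mono mult_left_mono) auto
  finally show ?thesis by (simp add: mult_ac)
qed

text \<open>The entry for \<open>U\<close> is smallest at \<open>t = sqrt (g + e / 16)\<close>; the
  values of \<open>t\<close> in the applications are near this optimum.\<close>

lemma dominated_one:
  assumes g: "\<delta>\<^sup>2 * Lf\<^sup>2 \<le> g" and e: "lam - chi4 \<le> e * q" and t: "0 < t"
    and c: "1 + t + (1 + 1 / t) * (g + e / 16) \<le> c" "81 / 64 \<le> c" "z \<le> c"
  shows "dominated 1 (c * (B / vmin))"
proof -
  note v = v_all_pos
  have g0: "0 \<le> g" using order_trans[OF _ g, of 0] by simp
  have bv: "0 \<le> B / vmin * v1" "0 \<le> B / vmin * v2" "0 \<le> B / vmin * v3" using B_nonneg v_pos v by auto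
  have "X 1 \<le> 81 / 64 * (B / vmin * v1)" using X_start_bound scaled_B by linarith
  also have "\<dots> \<le> c * (B / vmin * v1)" using c bv by (intro mult_right_mono) auto
  finally have x: "X 1 \<le> c * (B / vmin) * v1" by simp
  have "U 1 \<le> (1 + t + (1 + 1 / t) * g) * B + (1 + 1 / t) * (e / 16) * (B / vmin * v2)"
    using U_start_bound[OF t g e] .
  also have "\<dots> \<le> (1 + t + (1 + 1 / t) * g) * (B / vmin * v2) + (1 + 1 / t) * (e / 16) * (B / vmin * v2)"
    using scaled_B t g0 by (intro add_right_mono mult_left_mono) auto
  also have "\<dots> = (1 + t + (1 + 1 / t) * (g + e / 16)) * (B / vmin * v2)"
    by (simp only: ring_distribs mult_ac add_ac)
  also have "\<dots> \<le> c * (B / vmin * v2)" using c bv by (intro mult_right_mono) auto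
  finally have u: "U 1 \<le> c * (B / vmin) * v2" by simp
  have "z * (B / vmin * v3) \<le> c * (B / vmin * v3)" using c bv by (intro mult_right_mono) auto
  then have "G 1 \<le> c * (B / vmin) * v3" using G_start_bound by simp
  then show ?thesis using x u by (simp add: dominated_def)
qed

lemma dominated_mono:
  assumes "dominated k a" "a \<le> a'" shows "dominated k a'"
  using assms v_all_pos mult_right_mono[OF assms(2), of v1] mult_right_mono[OF assms(2), of v2]
    mult_right_mono[OF assms(2), of v3]
  unfolding dominated_def by linarith

lemma delta_Lf_le:
  assumes "c1 \<le> c" shows "\<delta>\<^sup>2 * Lf\<^sup>2 \<le> c\<^sup>2 / 96"
proof -
  have "c1\<^sup>2 \<le> c\<^sup>2" using assms c1_pos by (intro power_mono) auto
  then show ?thesis using delta_Lf_sq(2) by simp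
qed

lemma c1_le_1: "c1 \<le> 1"
  using c1_le[of 0] c2_pos by simp

lemma gap_half: "lam - chi4 \<le> 1 / 2 * q"
  using lam_bounds(4) z_less chi_pos(6,7) q_ge by simp

lemma dominated_one_level:
  assumes "3 / 4 \<le> z" shows "dominated 1 (level 1)"
proof -
  have bv: "0 \<le> B / vmin" using B_nonneg v_pos by simp
  define c where "c = 1732 / 1000 * z"
  have "dominated 1 (c * (B / vmin))"
  \<comment> \<open>For larger \<open>z\<close> crude bounds suffice: 1.4584 against at least
    1.4722. Below 0.85, \<open>c2 \<ge> 3 / 10\<close> and the smaller \<open>lam - chi4\<close>
    help; at \<open>z = 3 / 4\<close> the comparison is 1.2955 against 1.299.\<close>
  proof (cases "85 / 100 \<le> z")
    case True
    show ?thesis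
      by (rule dominated_one[OF delta_Lf_le[OF c1_le_1] gap_half, of "1 / 4"])
        (use True in \<open>auto simp: c_def power2_eq_square\<close>)
  next
    case False
    have "3 / 10 \<le> c2" using c2_gt False by simp
    from c1_le[OF this] have "c1 \<le> 518 / 1000" by simp
    from delta_Lf_le[OF this] have g: "\<delta>\<^sup>2 * Lf\<^sup>2 \<le> (518 / 1000)\<^sup>2 / 96" .
    have "(z - 54285 / 100000) * (q / (1187 / 1000)) \<le> (30715 / 100000) * (q / (1187 / 1000))"
      using False q_ge by (intro mult_right_mono) auto
    also have "\<dots> \<le> 2588 / 10000 * q" using q_ge(1) by simp
    finally have e: "lam - chi4 \<le> 2588 / 10000 * q" using chi_gap by (rule order_trans[rotated])
    show ?thesis
      by (rule dominated_one[OF g e, of "15 / 100"])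
        (use assms in \<open>auto simp: c_def power2_eq_square\<close>)
  qed
  moreover have "c * (B / vmin) \<le> sqrt 3 * z * (B / vmin)"
    unfolding c_def using sqrt3_ge z_half bv by (intro mult_right_mono) auto
  ultimately show ?thesis using dominated_mono by (simp add: mult_ac)
qed

text \<open>For small \<open>z\<close> the constant \<open>sqrt 3\<close> is not reached after one step. The first step is then
  saved by the spread of the eigenvector, and Young's inequality with parameter \<open>1 / 2\<close> gains
  enough in the second one.\<close>

lemma dominated_two_level:
  assumes z: "z < 3 / 4"
  shows "unsat 2 \<and> X 1 \<le> sqrt 3 * (vmax / vmin) * B * z ^ 1 \<and> dominated 2 (level 2)"
proof -
  note v = v_all_pos
  have bv: "0 \<le> B / vmin" using B_nonneg v_pos by simp
  have "1 < \<delta> * \<nu>" using c2_gt z by simp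
  then have G: "G k = 0" for k by (rule G_zero)
  define r where "r = vmax / vmin"
  have r: "2 \<le> r" using ratio_ge[OF z] v_pos by (simp add: r_def pos_le_divide_eq)
  have rB: "2 * B \<le> r * B" using r B_nonneg by (rule mult_right_mono)
  \<comment> \<open>At time 1 the bounds with \<open>vmax / vmin\<close> are enough to keep the
    second transmission in range. They are worth at least \<open>0.866 * r * B\<close>, and
    \<open>r \<ge> 2\<close> halves every plain \<open>B\<close>.\<close>
  have "1732 / 1000 * (1 / 2) * (r * B) \<le> sqrt 3 * z * (r * B)"
    using sqrt3_ge z_half r B_nonneg by (intro mult_right_mono mult_mono) auto
  then have M: "866 / 1000 * (r * B) \<le> sqrt 3 * (vmax / vmin) * B * z ^ 1"
    by (simp add: r_def mult_ac)
  have x1: "X 1 \<le> sqrt 3 * (vmax / vmin) * B * z ^ 1"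
    using X_start_bound M rB B_nonneg by linarith
  have "B / vmin * v2 \<le> r * B"
    using mult_left_mono[OF v_le(2) bv] by (simp add: r_def mult.commute)
  then have u1: "U 1 \<le> sqrt 3 * (vmax / vmin) * B * z ^ 1"
    using U_start_bound[OF _ delta_Lf_le[OF c1_le_1] gap_half, of "1 / 4"] M rB B_nonneg by simp
  have us: "unsat (Suc 1)"
    using unsat_start x1 u1 B_nonneg v v_pos z_half by (intro unsat_step) (auto simp: G)
  \<comment> \<open>The constant of \<open>X_start_bound\<close>. It can exceed
    \<open>sqrt 3 * z\<close>, so time 1 cannot start the induction.\<close>
  define a where "a = 81 / 64 * (B / vmin)"
  have a0: "0 \<le> a" using bv by (simp add: a_def)
  have "1 / 2 \<le> c2" using c2_gt z by simp
  from c1_le[OF this] have "c1 \<le> 35 / 100" by simp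
  from delta_Lf_le[OF this] have g: "\<delta>\<^sup>2 * Lf\<^sup>2 \<le> (35 / 100)\<^sup>2 / 96" .
  have "(z - 54285 / 100000) * (q / (1187 / 1000)) \<le> (20715 / 100000) * (q / (1187 / 1000))"
    using z q_ge by (intro mult_right_mono) auto
  also have "\<dots> \<le> 175 / 1000 * q" using q_ge(1) by simp
  finally have e: "lam - chi4 \<le> 175 / 1000 * q" using chi_gap by (rule order_trans[rotated])
  have dom: "dominated 1 a"
    unfolding a_def
    by (rule dominated_one[OF g e, of "1 / 10"]) (use z in \<open>auto simp: power2_eq_square\<close>)
  have "B * z ^ 1 \<le> B * (81 / 64)" using z B_nonneg by (intro mult_left_mono) auto
  then have Ba: "B * z ^ 1 \<le> a * vmin" using v_pos by (simp add: a_def)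
  \<comment> \<open>Parameter \<open>1 / 2\<close> gives the factors 3 / 2 and 3, and with
    \<open>chi1 = (1 + p) / 2\<close> all terms in \<open>p\<close> cancel. What remains is
    proportional to \<open>2 * z - 1\<close>, small for \<open>z\<close> near 1 / 2.\<close>
  have young: "3 / 2 * p * Y + 3 * W \<le> level 2 * w"
    if Y: "Y \<le> a * w" and W: "q * W \<le> a * w * (z - chi1)" and "0 \<le> W" "0 < w" for Y W w
  proof -
    have "W \<le> q * W" using q_ge that mult_right_mono[of 1 q W] by simp
    then have "3 / 2 * p * Y + 3 * W \<le> 3 / 2 * p * (a * w) + 3 * (a * w * (z - chi1))"
      using Y W p_bounds by (intro add_mono mult_left_mono) auto
    also have "\<dots> = (B / vmin * w) * (81 / 64 * (3 / 2) * (2 * z - 1))"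
      by (simp add: a_def chi1_eq algebra_simps add_divide_distrib diff_divide_distrib)
    also have "\<dots> \<le> (B / vmin * w) * (1732 / 1000 * z\<^sup>2)"
    proof (rule mult_left_mono)
      \<comment> \<open>In \<open>y\<close> the quadratic has positive coefficients: the polynomial
        below is 32000 times the difference of the two sides.\<close>
      define y where "y = 3 / 4 - z"
      have "0 \<le> y" using z by (simp add: y_def)
      then have "0 \<le> 55424 * (y * y) + 38364 * y + 801" by simp
      then show "81 / 64 * (3 / 2) * (2 * z - 1) \<le> 1732 / 1000 * z\<^sup>2"
        using \<open>0 \<le> y\<close> unfolding y_def power2_eq_square by (simp add: algebra_simps)
    qed (use B_nonneg v_pos that in simp)
    also have "\<dots> \<le> (B / vmin * w) * (sqrt 3 * z\<^sup>2)"
      using sqrt3_ge B_nonneg v_pos that by (intro mult_left_mono mult_right_mono) simp_all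
    finally show ?thesis by (simp add: mult_ac)
  qed
  have d: "X 1 \<le> a * v1" "U 1 \<le> a * v2" using dom by (auto simp: dominated_def)
  note pert = perturbation[OF order_refl unsat_start dom Ba]
  have "X (Suc 1) \<le> 3 / 2 * p * X 1 + 3 * (2 * b\<^sup>2 * Ex 1 + 2 * \<delta>\<^sup>2 * U 1)"
    using X_step[of "1 / 2" 1] by simp
  also have "\<dots> \<le> level 2 * v1" using d pert nonneg v by (intro young) auto
  finally have x: "X (Suc 1) \<le> level 2 * v1" .
  have "U (Suc 1) \<le> 3 / 2 * p * U 1
      + 3 * (2 * b\<^sup>2 * Eu 1 + 8 * Lf\<^sup>2 * (b\<^sup>2 * X 1 + b\<^sup>2 * Ex 1 + \<delta>\<^sup>2 * U 1 + \<delta>\<^sup>2 * N 1))"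
    using U_step[of "1 / 2" 1] by simp
  also have "\<dots> \<le> level 2 * v2" using d pert nonneg v by (intro young) auto
  finally have u: "U (Suc 1) \<le> level 2 * v2" .
  have "dominated (Suc 1) (level 2)"
    using x u mult_nonneg_nonneg[OF level_nonneg[of 2], of v3] v(3) by (simp add: dominated_def G)
  then show ?thesis using us x1 by (simp add: numeral_2_eq_2)
qed

theorem error_bound: "X k + G k \<le> 2 * (sqrt 3 * (vmax / vmin) * B) * z ^ k"
proof -
  let ?M = "\<lambda>k. sqrt 3 * (vmax / vmin) * B * z ^ k"
  have "X k \<le> ?M k \<and> G k \<le> ?M k"
  proof (cases "k = 0")
    case True
    have "1 * 1 * B \<le> sqrt 3 * (vmax / vmin) * B"
      using B_nonneg v_pos v_all_pos(4) by (intro mult_right_mono mult_mono) auto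
    then show ?thesis using start True by simp
  next
    case False
    show ?thesis
    proof (cases "3 / 4 \<le> z")
      case True
      have "dominated k (level k)"
        using dominated_level[OF order_refl unsat_start dominated_one_level[OF True]] False by simp
      then show ?thesis using dominated_level_bounds by simp
    next
      case small: False
      note two = dominated_two_level[OF not_le_imp_less[OF small]]
      show ?thesis
      \<comment> \<open>Time 1 lies before the start of the induction; its bound on \<open>X\<close>
        is a by-product of keeping the second transmission in range.\<close>
      proof (cases "k = 1")
        case True
        have "1 < \<delta> * \<nu>" using c2_gt small by simp
        then show ?thesis using two G_zero[of k] True B_nonneg v_pos v_all_pos z_half by simp
      next
        case False
        then have "2 \<le> k" using \<open>k \<noteq> 0\<close> by simp
        then have "dominated k (level k)" using dominated_level[of 2 k] two by simp
        then show ?thesis using dominated_level_bounds by simp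
      qed
    qed
  qed
  then have "X k + G k \<le> ?M k + ?M k" by (intro add_mono) auto
  then show ?thesis by (simp add: mult_ac)
qed

end

section \<open>Convergence\<close>

theorem theorem1:
  fixes E :: "('n::finite \<times> 'n) set"
    and A :: "real^'n^'n"
    and f :: "'n \<Rightarrow> real^'m \<Rightarrow> real"
    and x u xhat uhat :: "nat \<Rightarrow> real^'m^'n"
    and s :: "nat \<Rightarrow> real"
    and K :: nat
    and nm Lf \<nu> fstar \<beta> \<delta> \<mu> s0 Cx Cu :: real
    and d rhoL varrho c1 c2 Theta1 Theta2 iota rhobar h :: real
    and chi1 chi2 chi3 chi4 chi5 chi6 chi7 :: real
    and sigma1 sigma2 sigma3 sigma4 sigma5 sigma6 sigma7 sigma9 theta1 theta2 :: real
    and Phi :: "real^3^3" and zeta Lambda0 :: "real^3"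
  assumes agents: "CARD('n) \<ge> 2"
    and graph: "undirected_weighted_graph E A" "connected_graph E"
    and differentiable: "\<And>i y. f i differentiable (at y)"
    and smooth: "Lf > 0"
      "\<And>i y z. norm (grad (f i) y - grad (f i) z) \<le> Lf * norm (y - z)"
    and minimizer: "{y. \<forall>z. avg_objective f y \<le> avg_objective f z} \<noteq> {}"
    and fstar: "fstar = (INF y. avg_objective f y)"
    and PL: "\<nu> > 0"
      "\<And>y. 1 / 2 * (norm (grad (avg_objective f) y))\<^sup>2 \<ge> \<nu> * (avg_objective f y - fstar)"
    and run: "quantized_gradient_tracking f A \<beta> \<delta> s K x u xhat uhat"
    and s: "\<And>k. s k = s0 * \<mu> ^ k" "s0 > 0"
    and nm: "nm = real CARD('n) * real CARD('m)"
    and d: "d = max_degree A"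
    and rhoL: "rhoL = spectral_radius (laplacian A)"
    and varrho: "varrho = spectral_radius
      (mat 1 - \<beta> *\<^sub>R kronecker (laplacian A) (mat 1 :: real^'m^'m)
        - (1 / real CARD('n)) *\<^sub>R kronecker ((\<chi> i j. 1) :: real^'n^'n) (mat 1 :: real^'m^'m))"
    and c2: "0 < c2" "c2 < 1 - varrho\<^sup>2"
    and c1: "c1 = (1 - varrho\<^sup>2 - c2) * (1 - varrho\<^sup>2) / (1 + varrho\<^sup>2)"
    and Theta2: "Theta2 = c1 / (32 * Lf\<^sup>2)"
    and Theta1: "Theta1 = min (c1 / (24 * Lf\<^sup>2)) (\<nu> * Theta2 / (2 * Lf\<^sup>2))"
    and iota: "iota = min (c2 / 2) (\<delta> / 4 * \<nu>)"
    and rhobar: "rhobar = 1 - iota"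
    and sigma1: "sigma1 = (1 - varrho\<^sup>2) / (2 * varrho\<^sup>2)"
    and chi1: "chi1 = (1 + sigma1) * varrho\<^sup>2"
    and chi2: "chi2 = 2 * \<delta>\<^sup>2 * (1 + 1 / sigma1)"
    and chi3: "chi3 = (1 + 1 / sigma1) * 8 * Lf\<^sup>2
      * (\<beta>\<^sup>2 * rhoL\<^sup>2 + 2 * \<delta>\<^sup>2 * Lf\<^sup>2 / (1 - 2 * \<delta> * Lf))"
    and chi4: "chi4 = (1 + sigma1) * varrho\<^sup>2 + (1 + 1 / sigma1) * 8 * Lf\<^sup>2 * \<delta>\<^sup>2"
    and chi5: "chi5 = (1 + 1 / sigma1)
      * (16 * Lf\<^sup>2 * \<delta> * (2 - \<delta> * \<nu>) / (1 - 2 * \<delta> * Lf))"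
    and chi6: "chi6 = \<delta> / 2 * Lf\<^sup>2"
    and chi7: "chi7 = 1 - \<delta> / 2 * \<nu>"
    and Phi: "Phi = vector [vector [chi1, chi2, 0],
                            vector [chi3, chi4, chi5],
                            vector [chi6, 0, chi7]]"
    and zeta: "\<And>i. zeta $ i > 0" "Phi *v zeta = spectral_radius Phi *s zeta"
    and h: "h = sqrt 3 * (Max (range (\<lambda>i. zeta $ i)) / Min (range (\<lambda>i. zeta $ i)))"
    and sigma5: "sigma5 = (1 + 1 / sigma1) * 2 * \<beta>\<^sup>2 * rhoL\<^sup>2"
    and sigma2: "sigma2 = nm * sigma5 * sqrt (1 + (1 + 4 * Lf\<^sup>2)\<^sup>2)"
    and sigma6: "sigma6 = sqrt 3 * max (\<beta> * rhoL) \<delta>"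
    and sigma7: "sigma7 = max (1 - \<delta> / 2 * \<nu>) (\<delta> / 2 * Lf\<^sup>2)"
    and sigma3: "sigma3 = sigma6 * sqrt (2 + 4 * sigma7 / (\<delta> * (1 - 2 * \<delta> * Lf)))"
    and sigma4: "sigma4 = \<beta> * rhoL * (1 + Lf)
      + Lf * \<delta> * (1 + sqrt (4 * sigma7 / (\<delta> * (1 - 2 * \<delta> * Lf))))"
    and theta1: "theta1 = sigma3 * sqrt (h * sigma2 / (4 * \<mu>\<^sup>2 * (\<mu>\<^sup>2 - rhobar)))
      + (1 + 2 * \<beta> * d) / (2 * \<mu>) - 1 / 2"
    and theta2: "theta2 = sigma4 * sqrt (h * sigma2 / (4 * \<mu>\<^sup>2 * (\<mu>\<^sup>2 - rhobar)))
      + sqrt nm * Lf * \<beta> * rhoL / (2 * \<mu>) + (1 + 2 * \<beta> * d) / (2 * \<mu>) - 1 / 2"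
    and Lambda0: "Lambda0 = vector [(norm (x 0 - stacked_mean (x 0)))\<^sup>2,
                                    (norm (u 0 - stacked_mean (u 0)))\<^sup>2,
                                    real CARD('n) * (avg_objective f (agent_mean (x 0)) - fstar)]"
    and sigma9: "sigma9 = h * sigma2 * s0\<^sup>2 / (2 * \<mu>\<^sup>2 * (\<mu>\<^sup>2 - rhobar))"
    and beta_range: "0 < \<beta>" "\<beta> < sqrt 2 / (2 * rhoL)"
    and delta_range: "0 < \<delta>"
      "\<delta> < Min {sqrt (c1 * Theta1) / 2, 1 / (4 * Lf), 2 / \<nu>, 1 / (8 + 2 * Lf), sqrt c1 / (8 * Lf)}"
    and mu_range: "sqrt rhobar < \<mu>" "\<mu> < 1"
    and K_range: "K \<ge> 1" "real K \<ge> max theta1 theta2"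
    and initial_bounds: "Cx \<ge> infnorm (x 0)" "Cu \<ge> infnorm (u 0)"
    and s0_range: "s0 \<ge> Max {2 * (Cx + \<delta> * Cu) / (2 * real K + 1),
      2 * infnorm (grad (stacked_objective f) (x 0 - \<delta> *\<^sub>R u 0)) / (2 * real K + 1),
      sqrt (4 * norm Lambda0 * \<mu>\<^sup>2 * (\<mu>\<^sup>2 - rhobar) / sigma2)}"
  shows "\<forall>k. (norm (x k - stacked_mean (x k)))\<^sup>2
           + real CARD('n) * (avg_objective f (agent_mean (x k)) - fstar)
         \<le> sigma9 * \<mu> ^ (2 * k)"
proof -
  define p where "p = varrho\<^sup>2"
  define b where "b = \<beta> * rhoL"
  define q where "q = 1 + 1 / sigma1"
  define z where "z = \<mu>\<^sup>2"
  define B where "B = sigma2 * s0\<^sup>2 / (4 * z * (z - rhobar))"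
  define vmin where "vmin = Min (range (\<lambda>i. zeta $ i))"
  define vmax where "vmax = Max (range (\<lambda>i. zeta $ i))"
  define lam where "lam = spectral_radius Phi"
  have sym: "transpose A = A" and A_nonneg: "0 \<le> A $ i $ j" for i j
  proof -
    show "transpose A = A" using graph(1) by (simp add: undirected_weighted_graph_def)
    have "if (j, i) \<in> E then A $ i $ j > 0 else A $ i $ j = 0"
      using graph(1) unfolding undirected_weighted_graph_def by blast
    then show "0 \<le> A $ i $ j" by (auto split: if_splits)
  qed
  have rhoL_pos: "0 < rhoL"
  proof (rule ccontr)
    assume "\<not> 0 < rhoL"
    \<comment> \<open>The range of \<open>\<beta>\<close> would be empty; for
      \<open>rhoL = 0\<close> the quotient is 0.\<close>
    then have "sqrt 2 / (2 * rhoL) \<le> 0" by (intro divide_nonneg_nonpos) auto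
    then show False using beta_range by linarith
  qed
  have b: "0 < b" "b < sqrt 2 / 2"
    using beta_range rhoL_pos by (auto simp: b_def field_simps)
  have contraction: "norm (y - \<beta> *\<^sub>R block_mult (laplacian A) y - stacked_mean y) \<le> varrho * norm y"
    for y :: "real^'m^'n"
    unfolding varrho by (rule consensus_norm_le[OF transpose_laplacian[OF sym]])
  have laplacian_bound: "norm (\<beta> *\<^sub>R block_mult (laplacian A) y) \<le> b * norm y" for y :: "real^'m^'n"
    using norm_block_mult_le[OF transpose_laplacian[OF sym], of y] beta_range
    by (simp add: b_def rhoL mult.assoc)
  have "1 - b \<le> varrho" by (rule consensus_rate_ge[OF agents contraction laplacian_bound])
  moreover have "0 < 1 - b" using b(2) sqrt2_less_2 by simp
  ultimately have varrho_pos: "0 < varrho" and p_ge: "(1 - b)\<^sup>2 \<le> p"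
    by (auto simp: p_def intro!: power_mono)
  have p: "0 < p" "p < 1" using varrho_pos c2 by (auto simp: p_def)
  have sigma1_pos: "0 < sigma1" and sigma1_p: "sigma1 = (1 - p) / (2 * p)"
    using p by (auto simp: sigma1 p_def)
  have chi1': "(1 + sigma1) * p = (1 + p) / 2" using p by (simp add: sigma1_p field_simps)
  have q': "q = (1 + p) / (1 - p)" using p by (simp add: q_def sigma1_p field_simps)
  have deltas: "\<delta> < sqrt (c1 * Theta1) / 2" "\<delta> < 1 / (4 * Lf)" "\<delta> < 2 / \<nu>"
    "\<delta> < 1 / (8 + 2 * Lf)" "\<delta> < sqrt c1 / (8 * Lf)"
    using delta_range(2) by simp_all
  have iota: "iota \<le> c2 / 2" by (simp add: iota)
  then have "1 / 2 < rhobar" using c2(2) p(1) unfolding rhobar p_def by linarith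
  then have mu_pos: "0 < \<mu>" using mu_range(1) real_sqrt_ge_zero[of rhobar] by linarith
  have z: "rhobar < z" "z < 1"
  proof -
    have "(sqrt rhobar)\<^sup>2 < \<mu>\<^sup>2"
      using mu_range(1) \<open>1 / 2 < rhobar\<close> by (intro power_strict_mono) auto
    then show "rhobar < z" using \<open>1 / 2 < rhobar\<close> by (simp add: z_def)
    show "z < 1" using mu_range mu_pos by (simp add: z_def power_less_one_iff)
  qed
  have z_pos: "0 < z" using mu_pos by (simp add: z_def)
  have v: "vmin \<le> zeta $ i" "zeta $ i \<le> vmax" for i by (auto simp: vmin_def vmax_def)
  have "vmin \<in> range (\<lambda>i. zeta $ i)" unfolding vmin_def by (rule Min_in) auto
  then have vmin: "0 < vmin" using zeta(1) by auto
  have h_eq: "h = sqrt 3 * (vmax / vmin)" by (simp add: h vmin_def vmax_def)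
  have row: "(Phi *v zeta) $ i = lam * zeta $ i" for i by (simp add: zeta(2) lam_def)
  have rows: "chi1 * zeta $ 1 + chi2 * zeta $ 2 = lam * zeta $ 1"
    "chi3 * zeta $ 1 + chi4 * zeta $ 2 + chi5 * zeta $ 3 = lam * zeta $ 2"
    "chi6 * zeta $ 1 + chi7 * zeta $ 3 = lam * zeta $ 3"
    using row[of 1] row[of 2] row[of 3]
    by (simp_all add: Phi matrix_vector_mult_def sum_3)

  interpret tracking_gains b \<delta> Lf \<nu> p c2 c1 Theta1 Theta2 rhobar q chi1 chi2 chi3 chi4 chi5 chi6 chi7
    lam "zeta $ 1" "zeta $ 2" "zeta $ 3" vmin vmax z
  proof
    show "chi1 = (1 + p) / 2" using chi1' by (simp add: chi1 p_def)
    show "chi4 = (1 + p) / 2 + q * 8 * Lf\<^sup>2 * \<delta>\<^sup>2" using chi1' by (simp add: chi4 p_def q_def)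
    show "chi3 = q * 8 * Lf\<^sup>2 * (b\<^sup>2 + 2 * \<delta>\<^sup>2 * Lf\<^sup>2 / (1 - 2 * \<delta> * Lf))"
      by (simp add: chi3 q_def b_def power_mult_distrib)
    show "rhobar = 1 - min (c2 / 2) (\<delta> / 4 * \<nu>)" by (simp add: rhobar assms)
  qed (use b p_ge smooth(1) PL(1) c2 c1 Theta2 Theta1 q' chi2 chi5 chi6 chi7 delta_range(1) deltas
      vmin v rows z in \<open>simp_all add: p_def q_def\<close>)

  have fstar_le: "fstar \<le> avg_objective f y" for y
  proof -
    obtain y0 where "\<forall>z. avg_objective f y0 \<le> avg_objective f z" using minimizer by auto
    then have "bdd_below (range (avg_objective f))" by (auto intro!: bdd_belowI2)
    then show ?thesis unfolding fstar by (intro cINF_lower) auto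
  qed
  interpret run: gradient_tracking_run A f s K x u xhat uhat Lf \<nu> fstar \<beta> \<delta> varrho b
  proof
    show "0 \<le> b" using b by simp
  qed (use sym A_nonneg differentiable smooth fstar_le PL(2) run beta_range delta_range contraction
      laplacian_bound in simp_all)

  have n_pos: "0 < nm" by (simp add: nm)
  have sigma5': "sigma5 = q * 2 * b\<^sup>2" by (simp add: sigma5 q_def b_def power_mult_distrib)
  have q_pos: "0 < q" using q_ge by simp
  have sigma5_pos: "0 < sigma5" using q_pos b by (simp add: sigma5')
  \<comment> \<open>The square root is the Euclidean norm of the noise weights 1 and
    \<open>1 + 4 * Lf\<^sup>2\<close> of the rows for \<open>X\<close> and \<open>U\<close>, so it
    dominates each of them.\<close>
  have root: "1 \<le> 1 + 4 * Lf\<^sup>2" "1 + 4 * Lf\<^sup>2 \<le> sqrt (1 + (1 + 4 * Lf\<^sup>2)\<^sup>2)"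
    by (auto intro!: real_le_rsqrt)
  have sigma2_pos: "0 < sigma2" unfolding sigma2
    using n_pos sigma5_pos root by (intro mult_pos_pos) linarith+
  have gap: "0 < 4 * z * (z - rhobar)" using z z_pos by simp
  have B_nonneg: "0 \<le> B" using sigma2_pos gap by (simp add: B_def)
  \<comment> \<open>The radius \<open>s0 * \<mu> ^ k / (2 * \<mu>)\<close> is half of the scale at
    time \<open>k - 1\<close>, with which the values of time \<open>k\<close> are quantized.\<close>
  have Bz: "B * z ^ k * (z - rhobar) = sigma2 * (s0 * \<mu> ^ k / (2 * \<mu>))\<^sup>2" for k
  proof -
    have "(\<mu> ^ k)\<^sup>2 = z ^ k" by (simp add: z_def power_mult[symmetric] mult.commute)
    then have "(s0 * \<mu> ^ k / (2 * \<mu>))\<^sup>2 = s0\<^sup>2 * z ^ k / (4 * z)"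
      by (simp add: power_divide power_mult_distrib z_def)
    moreover have "B * (z - rhobar) = sigma2 * s0\<^sup>2 / (4 * z)" using z z_pos by (simp add: B_def)
    then have "(B * (z - rhobar)) * z ^ k = sigma2 * s0\<^sup>2 / (4 * z) * z ^ k" by (rule arg_cong)
    then have "B * z ^ k * (z - rhobar) = sigma2 * s0\<^sup>2 / (4 * z) * z ^ k" by (simp only: mult_ac)
    ultimately show ?thesis by simp
  qed

  define S where "S = sqrt (h * sigma2 / (4 * \<mu>\<^sup>2 * (\<mu>\<^sup>2 - rhobar)))"
  have h_pos: "0 < h" using vmin v_all_pos by (simp add: h_eq)
  \<comment> \<open>\<open>S\<close> is the root occurring in \<open>theta1\<close> and
    \<open>theta2\<close>: the squared errors are bounded by the square of
    \<open>s k * S\<close>.\<close>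
  have level_eq: "sqrt 3 * (vmax / vmin) * B * z ^ k = (s0 * \<mu> ^ k * S)\<^sup>2" for k
  proof -
    have "S\<^sup>2 = h * sigma2 / (4 * z * (z - rhobar))"
      using h_pos sigma2_pos gap by (simp add: S_def z_def)
    moreover have "(\<mu> ^ k)\<^sup>2 = z ^ k" by (simp add: z_def power_mult[symmetric] mult.commute)
    ultimately show ?thesis by (simp add: power_mult_distrib B_def h_eq)
  qed
  have S_nonneg: "0 \<le> S" using h_pos sigma2_pos gap by (simp add: S_def z_def)

  define unsat where "unsat k \<longleftrightarrow> run.precise k (s0 * \<mu> ^ k / (2 * \<mu>))" for k
  have r_pos: "0 \<le> s0 * \<mu> ^ k / (2 * \<mu>)" for k using s(2) mu_pos by simp
  have D_pos: "0 < \<delta> * (1 - 2 * \<delta> * Lf)" using delta_linear delta_pos by simp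
  \<comment> \<open>The bound on \<open>N\<close> relative to that on \<open>X\<close> and
    \<open>G\<close>: a factor 2 comes from \<open>\<delta> / 2\<close>, another from adding two
    terms bounded by \<open>sigma7\<close>.\<close>
  define \<kappa> where "\<kappa> = 4 * sigma7 / (\<delta> * (1 - 2 * \<delta> * Lf))"
  have sigma7: "chi7 \<le> sigma7" "chi6 \<le> sigma7" by (auto simp: sigma7 chi7 chi6)
  have kappa_nonneg: "0 \<le> \<kappa>" using sigma7 chi_pos D_pos by (simp add: \<kappa>_def)

  have unsat_step: "unsat (Suc k)"
    if k: "unsat k" and XM: "run.X k \<le> sqrt 3 * (vmax / vmin) * B * z ^ k"
      and UM: "run.U k \<le> sqrt 3 * (vmax / vmin) * B * z ^ k"
      and GM: "run.G k \<le> sqrt 3 * (vmax / vmin) * B * z ^ k" for k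
  proof -
    define T where "T = s0 * \<mu> ^ k * S"
    define r where "r = s0 * \<mu> ^ k / (2 * \<mu>)"
    have T0: "0 \<le> T" using s(2) mu_pos S_nonneg by (simp add: T_def)
    have XUG: "run.X k \<le> T\<^sup>2" "run.U k \<le> T\<^sup>2" "run.G k \<le> T\<^sup>2"
      using XM UM GM unfolding level_eq T_def by simp_all
    have xT: "norm (run.dev (x k)) \<le> T" "norm (run.dev (u k)) \<le> T"
      using XUG(1,2) T0 unfolding run.X_def run.U_def by (auto intro: power2_le_imp_le)
    have "\<delta> / 2 * (1 - \<delta> * Lf) * run.N k \<le> (1 - \<delta> * \<nu>) * run.G k + \<delta> / 2 * Lf\<^sup>2 * run.X k"
      using run.descent[of k] run.G_nonneg[of "Suc k"] by linarith
    then have "\<delta> / 2 * (1 - 2 * \<delta> * Lf) * run.N k \<le> chi7 * run.G k + chi6 * run.X k"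
      by (intro mean_gradient_bounds) (auto simp: run.G_nonneg run.X_def run.N_def)
    also have "\<dots> \<le> sigma7 * T\<^sup>2 + sigma7 * T\<^sup>2"
      using sigma7 XUG chi_pos run.G_nonneg by (intro add_mono mult_mono) (auto simp: run.X_def)
    finally have "run.N k * (\<delta> * (1 - 2 * \<delta> * Lf)) \<le> 4 * sigma7 * T\<^sup>2" by (simp add: mult_ac)
    then have N: "run.N k \<le> \<kappa> * T\<^sup>2"
      using D_pos pos_le_divide_eq[of "\<delta> * (1 - 2 * \<delta> * Lf)"] by (simp add: \<kappa>_def)
    define w where "w = norm (stacked_mean (u k))"
    have w: "w\<^sup>2 \<le> \<kappa> * T\<^sup>2" "0 \<le> w" using N by (simp_all add: w_def run.N_def)
    have w': "w \<le> sqrt \<kappa> * T"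
      by (rule power2_le_imp_le) (use w kappa_nonneg T0 in \<open>auto simp: power_mult_distrib\<close>)
    have pr: "run.precise k r" using k by (simp add: unsat_def r_def)
    have r0: "0 \<le> r" using r_pos by (simp add: r_def)
    show ?thesis
    proof -
      have sk: "s k = s0 * \<mu> ^ k" by (rule s(1))
      have "run.precise (Suc k) (s k / 2)"
      proof (rule run.precise_Suc)
        show "0 < s k" using s mu_pos by simp
        fix i c
        define m where "m = max b \<delta>"
        have m: "b \<le> m" "\<delta> \<le> m" "0 \<le> m" using b by (auto simp: m_def)
        have "b * T + \<delta> * T + \<delta> * w \<le> m * T + m * T + m * w"
          using m T0 w by (intro add_mono mult_right_mono) auto
        also have "\<dots> = m * (T + T + w)" by (simp add: algebra_simps)
        also have "\<dots> \<le> m * (sqrt 3 * (sqrt (2 + \<kappa>) * T))"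
        proof (rule mult_left_mono)
          \<comment> \<open>Cauchy-Schwarz for three summands, the origin of the
            \<open>sqrt 3\<close> in \<open>sigma6\<close>.\<close>
          have "(T + T + w)\<^sup>2 \<le> 3 * (T\<^sup>2 + T\<^sup>2 + w\<^sup>2)"
          proof -
            have "0 \<le> 2 * (T - w)\<^sup>2" by simp
            then show ?thesis by (simp add: power2_eq_square algebra_simps)
          qed
          also have "\<dots> \<le> 3 * ((2 + \<kappa>) * T\<^sup>2)" using w by (simp add: algebra_simps)
          also have "\<dots> = (sqrt 3 * (sqrt (2 + \<kappa>) * T))\<^sup>2"
            using kappa_nonneg by (simp add: power_mult_distrib)
          finally show "T + T + w \<le> sqrt 3 * (sqrt (2 + \<kappa>) * T)"
            by (rule power2_le_imp_le) (use kappa_nonneg T0 in simp)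
        qed (rule m)
        also have "\<dots> = sigma3 * T" by (simp add: sigma3 sigma6 m_def b_def \<kappa>_def)
        finally have "\<bar>(x (Suc k) - xhat k) $ i $ c\<bar> \<le> (1 + 2 * \<beta> * max_degree A) * r + sigma3 * T"
          using run.quantizer_input_x[OF pr xT, of w i c] by (simp add: w_def)
        \<comment> \<open>The \<open>- 1 / 2\<close> in \<open>theta1\<close> reflects that the
          unsaturated range ends at \<open>K + 1 / 2\<close>.\<close>
        also have "\<dots> = (theta1 + 1 / 2) * s k"
          by (simp add: theta1 d r_def T_def S_def sk algebra_simps add_divide_distrib)
        also have "\<dots> \<le> (real K + 1 / 2) * s k"
          using K_range(2) s mu_pos by (intro mult_right_mono) auto
        finally show "\<bar>(x (Suc k) - xhat k) $ i $ c\<bar> \<le> (real K + 1 / 2) * s k" .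
        have ek: "norm (run.ex k) \<le> sqrt nm * r"
          unfolding nm by (rule run.precise_norm(3)[OF pr r0])
        have "Lf * \<delta> * w \<le> Lf * \<delta> * (sqrt \<kappa> * T)"
          using w' smooth(1) delta_pos by (intro mult_left_mono) auto
        then have "b * T + Lf * (b * (sqrt nm * r) + b * T + \<delta> * T + \<delta> * w)
          \<le> sigma4 * T + sqrt nm * Lf * b * r"
          unfolding sigma4 \<kappa>_def[symmetric] b_def[symmetric] by (simp add: algebra_simps)
        then have "\<bar>(u (Suc k) - uhat k) $ i $ c\<bar> \<le> (1 + 2 * \<beta> * max_degree A) * r
            + (sigma4 * T + sqrt nm * Lf * b * r)"
          using run.quantizer_input_u[OF pr xT _ ek, of w i c] by (simp add: w_def)
        also have "\<dots> = (theta2 + 1 / 2) * s k"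
          by (simp add: theta2 d r_def T_def S_def b_def sk algebra_simps add_divide_distrib)
        also have "\<dots> \<le> (real K + 1 / 2) * s k"
          using K_range(2) s mu_pos by (intro mult_right_mono) auto
        finally show "\<bar>(u (Suc k) - uhat k) $ i $ c\<bar> \<le> (real K + 1 / 2) * s k" .
      qed
      moreover have "s k / 2 = s0 * \<mu> ^ Suc k / (2 * \<mu>)" using mu_pos by (simp add: sk)
      ultimately show ?thesis by (simp add: unsat_def)
    qed
  qed

  have s0_bounds: "2 * (Cx + \<delta> * Cu) / (2 * real K + 1) \<le> s0"
    "2 * infnorm (grad (stacked_objective f) (x 0 - \<delta> *\<^sub>R u 0)) / (2 * real K + 1) \<le> s0"
    "sqrt (4 * norm Lambda0 * \<mu>\<^sup>2 * (\<mu>\<^sup>2 - rhobar) / sigma2) \<le> s0"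
    using s0_range by simp_all
  have unsat_1: "unsat 1"
  proof -
    have "run.precise 1 (s 0 / 2)"
      using s0_bounds(1,2) s initial_bounds
      by (intro run.precise_1[of Cx Cu]) (auto simp: divide_le_eq algebra_simps)
    then show ?thesis using mu_pos by (simp add: unsat_def s(1))
  qed
  have Lambda0_le: "norm Lambda0 \<le> B"
  proof -
    have "(sqrt (4 * norm Lambda0 * \<mu>\<^sup>2 * (\<mu>\<^sup>2 - rhobar) / sigma2))\<^sup>2 \<le> s0\<^sup>2"
      using s0_bounds(3) z z_pos sigma2_pos by (intro power_mono) (auto simp: z_def)
    then have "norm Lambda0 * (4 * z * (z - rhobar)) / sigma2 \<le> s0\<^sup>2"
      using z z_pos sigma2_pos by (simp add: z_def mult_ac)
    then show ?thesis
      using sigma2_pos gap by (simp add: B_def pos_le_divide_eq pos_divide_le_eq mult_ac)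
  qed
  have L0: "run.X 0 \<le> norm Lambda0" "run.U 0 \<le> norm Lambda0" "run.G 0 \<le> norm Lambda0"
    using component_le_norm_cart[of Lambda0 1] component_le_norm_cart[of Lambda0 2]
      component_le_norm_cart[of Lambda0 3]
    by (auto simp: Lambda0 run.X_def run.U_def run.G_def)

  have noise: "q * (2 * b\<^sup>2 * (norm (run.ex k))\<^sup>2) \<le> B * z ^ k * (z - rhobar)"
    "q * (2 * b\<^sup>2 * ((norm (run.eu k))\<^sup>2 + 4 * Lf\<^sup>2 * (norm (run.ex k))\<^sup>2)) \<le> B * z ^ k * (z - rhobar)"
    if "unsat k" for k
  proof -
    define r where "r = s0 * \<mu> ^ k / (2 * \<mu>)"
    have pr: "run.precise k r" "0 \<le> r" using that r_pos by (auto simp: unsat_def r_def)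
    have E: "(norm (run.ex k))\<^sup>2 \<le> nm * r\<^sup>2" "(norm (run.eu k))\<^sup>2 \<le> nm * r\<^sup>2"
      using run.precise_norm(1,2)[OF pr] by (simp_all add: nm)
    have c: "sigma5 * ((1 + 4 * Lf\<^sup>2) * (nm * r\<^sup>2)) \<le> B * z ^ k * (z - rhobar)"
    proof -
      have "(nm * sigma5 * r\<^sup>2) * (1 + 4 * Lf\<^sup>2) \<le> (nm * sigma5 * r\<^sup>2) * sqrt (1 + (1 + 4 * Lf\<^sup>2)\<^sup>2)"
        using root(2) n_pos sigma5_pos by (intro mult_left_mono) auto
      then show ?thesis unfolding Bz r_def[symmetric] sigma2 by (simp add: mult_ac)
    qed
    have "4 * Lf\<^sup>2 * (norm (run.ex k))\<^sup>2 \<le> 4 * Lf\<^sup>2 * (nm * r\<^sup>2)"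
      using E(1) by (intro mult_left_mono) auto
    with E(2) have "(norm (run.eu k))\<^sup>2 + 4 * Lf\<^sup>2 * (norm (run.ex k))\<^sup>2 \<le> (1 + 4 * Lf\<^sup>2) * (nm * r\<^sup>2)"
      by (simp add: algebra_simps)
    then have "sigma5 * ((norm (run.eu k))\<^sup>2 + 4 * Lf\<^sup>2 * (norm (run.ex k))\<^sup>2) \<le> B * z ^ k * (z - rhobar)"
      using c sigma5_pos by (intro order_trans[OF mult_left_mono c]) auto
    then show "q * (2 * b\<^sup>2 * ((norm (run.eu k))\<^sup>2 + 4 * Lf\<^sup>2 * (norm (run.ex k))\<^sup>2)) \<le> B * z ^ k * (z - rhobar)"
      by (simp add: sigma5' mult_ac)
    have "1 * (nm * r\<^sup>2) \<le> (1 + 4 * Lf\<^sup>2) * (nm * r\<^sup>2)"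
      using root(1) n_pos by (intro mult_right_mono) auto
    then have "(norm (run.ex k))\<^sup>2 \<le> (1 + 4 * Lf\<^sup>2) * (nm * r\<^sup>2)" using E(1) by linarith
    then have "sigma5 * (norm (run.ex k))\<^sup>2 \<le> B * z ^ k * (z - rhobar)"
      using c sigma5_pos by (intro order_trans[OF mult_left_mono c]) auto
    then show "q * (2 * b\<^sup>2 * (norm (run.ex k))\<^sup>2) \<le> B * z ^ k * (z - rhobar)"
      by (simp add: sigma5' mult_ac)
  qed

  interpret tracking_errors b \<delta> Lf \<nu> p c2 c1 Theta1 Theta2 rhobar q chi1 chi2 chi3 chi4 chi5 chi6 chi7
    lam "zeta $ 1" "zeta $ 2" "zeta $ 3" vmin vmax z run.X run.U run.G run.N
    "\<lambda>k. (norm (run.ex k))\<^sup>2" "\<lambda>k. (norm (run.eu k))\<^sup>2" B unsat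
  proof
    fix k :: nat and t :: real
    show "run.G (Suc k) + \<delta> / 2 * (1 - \<delta> * Lf) * run.N k \<le> (1 - \<delta> * \<nu>) * run.G k + \<delta> / 2 * Lf\<^sup>2 * run.X k"
      by (rule run.descent)
    show "1 < \<delta> * \<nu> \<Longrightarrow> run.G k = 0" using delta_linear by (intro run.G_zero) auto
    show "0 < t \<Longrightarrow> run.X 1 \<le> (1 + t) * run.X 0 + (1 + 1 / t) * (\<delta>\<^sup>2 * run.U 0)"
      by (rule run.X_start)
    show "0 < t \<Longrightarrow> run.U 1 \<le> (1 + t) * run.U 0 + (1 + 1 / t) * (\<delta>\<^sup>2 * Lf\<^sup>2 * (run.U 0 + run.N 0))"
      by (rule run.U_start)
    show "0 < t \<Longrightarrow> run.X (Suc k) \<le> (1 + t) * p * run.X k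
        + (1 + 1 / t) * (2 * b\<^sup>2 * (norm (run.ex k))\<^sup>2 + 2 * \<delta>\<^sup>2 * run.U k)"
      unfolding p_def by (rule run.X_step)
    show "0 < t \<Longrightarrow> run.U (Suc k) \<le> (1 + t) * p * run.U k + (1 + 1 / t) * (2 * b\<^sup>2 * (norm (run.eu k))\<^sup>2
        + 8 * Lf\<^sup>2 * (b\<^sup>2 * run.X k + b\<^sup>2 * (norm (run.ex k))\<^sup>2 + \<delta>\<^sup>2 * run.U k + \<delta>\<^sup>2 * run.N k))"
      unfolding p_def by (rule run.U_step)
    show "0 \<le> run.X k" "0 \<le> run.U k" "0 \<le> run.N k" by (simp_all add: run.X_def run.U_def run.N_def)
  qed (use run.G_nonneg B_nonneg L0 Lambda0_le noise unsat_1 unsat_step in auto)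

  show ?thesis
  proof
    fix k
    have "\<mu> ^ (2 * k) = z ^ k" by (simp add: z_def power_mult)
    \<comment> \<open>The factor 2 adds the separate bounds on disagreement and gap.\<close>
    moreover have "sigma9 = 2 * (h * B)" by (simp add: sigma9 B_def z_def)
    ultimately have "sigma9 * \<mu> ^ (2 * k) = 2 * (sqrt 3 * (vmax / vmin) * B) * z ^ k"
      by (simp add: h_eq)
    then show "(norm (x k - stacked_mean (x k)))\<^sup>2
           + real CARD('n) * (avg_objective f (agent_mean (x k)) - fstar) \<le> sigma9 * \<mu> ^ (2 * k)"
      using error_bound[of k] by (simp add: run.X_def run.G_def)
  qed
qed

end
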